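(* Let $F$ be an algebraically closed field of prime characteristic $p$ and let $\mathfrak{g}=\langle x\rangle\ltimes\mathfrak{a}$ be a finite dimensional Lie algebra over $F$, where $\mathfrak{a}$ is an abelian ideal on which $\mathrm{ad}\,x$ acts diagonalizably. Let $U$ be a finite dimensional admissible uniserial $\mathfrak{g}$-module of composition length $m>p$ which is not annihilated by $[\mathfrak{g},\mathfrak{g}]$. Then: (1) $m=\dim(U)>1$. (2) Let $S$ be the set of eigenvalues $\delta$ of $\mathrm{ad}\,x$ acting on $\mathfrak{a}$ such that the corresponding eigenspace $\mathfrak{a}(\delta)$ does not act trivially on $U$. Then, after replacing $x$ by a suitable scalar multiple, $1\in S$ and every element of $S$ is in the prime subfield of $F$. With $x$ so replaced: (3) Suppose that $U$ is faithful and let $i$ be an eigenvalue of $\mathrm{ad}\,x$ acting on $\mathfrak{a}$ (an element of the prime subfield, identified with an integer $0\le i<p$). Then the multiplicity of $i$ is bounded above by $\left\lfloor\frac{m-(i+1)}{p}\right\rfloor+1$. (4) Fix a non-zero $v\in\mathfrak{a}(1)$. Then there are linear maps $g^i:\mathfrak{a}(i)\to F[J^p]J^i$, for $0\le i<p$, satisfying $g^1(v)=J$, a scalar $\alpha\in F$, a matrix $Y\in D+F[J^p]J$, where $J=J_m(0)$ and $D=\mathrm{diag}(\alpha,\alpha-1,\dots,\alpha-(m-1))$, and a basis of $U$ relative to which $x$ is represented by $Y$ and every $u\in\mathfrak{a}(i)$, $0\le i<p$, is represented by $g^i(u)$.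
   Context: A $\mathfrak{g}$-module is admissible if every element of $[\mathfrak{g},\mathfrak{g}]$ acts on it via a nilpotent operator. A module is uniserial if it has a unique composition series. For $\delta\in F$, $\mathfrak{a}(\delta)=\{v\in\mathfrak{a}\,|\,[x,v]=\delta v\}$ (possibly zero), computed with respect to the rescaled $x$ after the rescaling; integers are viewed as elements of $F$ through the canonical map $\mathbb{Z}\to F$. $J_m(0)$ is the $m\times m$ upper triangular Jordan block with eigenvalue $0$. $F[J^p]$ is the algebra of all polynomials in $J^p$ with coefficients in $F$, $F[J^p]J^i=\{h(J^p)J^i\,|\,h\in F[X]\}$, and $D+F[J^p]J=\{D+h(J^p)J\,|\,h\in F[X]\}$.
   Formalization: In (4), Y is taken in D+F[J^p]J^p instead of D+F[J^p]J (false as printed, e.g. p=2, m=5, x acting as D+J^2, v as J), and v in a(1) is required to satisfy v^{m-1}≠0 on U rather than v≠0 (necessary for v to be represented by J); existence of such v is also proved. *)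

theory Defs
  imports
    "HOL-Computational_Algebra.Polynomial"
    "HOL-Computational_Algebra.Primes"
    "Jordan_Normal_Form.Jordan_Normal_Form"
begin

section \<open>Lie algebras and their modules\<close>

locale lie_algebra = vector_space scale
  for scale :: "'f::field \<Rightarrow> 'g::ab_group_add \<Rightarrow> 'g" +
  fixes bracket :: "'g \<Rightarrow> 'g \<Rightarrow> 'g"
  assumes bracket_linear_right: "\<And>y. Vector_Spaces.linear scale scale (\<lambda>z. bracket y z)"
    and bracket_linear_left: "\<And>z. Vector_Spaces.linear scale scale (\<lambda>y. bracket y z)"
    and bracket_self: "\<And>y. bracket y y = 0"
    and jacobi: "\<And>y z w. bracket y (bracket z w) + bracket z (bracket w y) + bracket w (bracket y z) = 0"

locale lie_module = lie_algebra scale bracket + U: vector_space uscale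
  for scale :: "'f::field \<Rightarrow> 'g::ab_group_add \<Rightarrow> 'g"
    and bracket :: "'g \<Rightarrow> 'g \<Rightarrow> 'g"
    and uscale :: "'f \<Rightarrow> 'u::ab_group_add \<Rightarrow> 'u" +
  fixes act :: "'g \<Rightarrow> 'u \<Rightarrow> 'u"
  assumes act_linear_right: "\<And>y. Vector_Spaces.linear uscale uscale (\<lambda>u. act y u)"
    and act_linear_left: "\<And>u. Vector_Spaces.linear scale uscale (\<lambda>y. act y u)"
    and act_bracket: "\<And>y z u. act (bracket y z) u = act y (act z u) - act z (act y u)"

definition derived_algebra ::
  "('f::field \<Rightarrow> 'g::ab_group_add \<Rightarrow> 'g) \<Rightarrow> ('g \<Rightarrow> 'g \<Rightarrow> 'g) \<Rightarrow> 'g set" where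
  "derived_algebra scale bracket = module.span scale {bracket y z |y z. True}"

definition abelian_ideal ::
  "('f::field \<Rightarrow> 'g::ab_group_add \<Rightarrow> 'g) \<Rightarrow> ('g \<Rightarrow> 'g \<Rightarrow> 'g) \<Rightarrow> 'g set \<Rightarrow> bool" where
  "abelian_ideal scale bracket A \<longleftrightarrow> module.subspace scale A
     \<and> (\<forall>y. \<forall>a\<in>A. bracket y a \<in> A) \<and> (\<forall>a\<in>A. \<forall>b\<in>A. bracket a b = 0)"

text \<open>The whole algebra is the internal direct sum of the line through \<open>x\<close> and \<open>A\<close>.\<close>

definition line_complement ::
  "('f::field \<Rightarrow> 'g::ab_group_add \<Rightarrow> 'g) \<Rightarrow> 'g \<Rightarrow> 'g set \<Rightarrow> bool" where
  "line_complement scale x A \<longleftrightarrow>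
     module.span scale {x} \<inter> A = {0} \<and> {s + a |s a. s \<in> module.span scale {x} \<and> a \<in> A} = UNIV"

definition ad_diagonalizable_on ::
  "('f::field \<Rightarrow> 'g::ab_group_add \<Rightarrow> 'g) \<Rightarrow> ('g \<Rightarrow> 'g \<Rightarrow> 'g) \<Rightarrow> 'g \<Rightarrow> 'g set \<Rightarrow> bool" where
  "ad_diagonalizable_on scale bracket x A \<longleftrightarrow>
     (\<exists>B \<subseteq> A. \<not> module.dependent scale B \<and> module.span scale B = A
        \<and> (\<forall>b\<in>B. \<exists>\<delta>. bracket x b = scale \<delta> b))"

definition ad_eigenspace ::
  "('f::field \<Rightarrow> 'g::ab_group_add \<Rightarrow> 'g) \<Rightarrow> ('g \<Rightarrow> 'g \<Rightarrow> 'g) \<Rightarrow> 'g set \<Rightarrow> 'g \<Rightarrow> 'f \<Rightarrow> 'g set" where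
  "ad_eigenspace scale bracket A x \<delta> = {v \<in> A. bracket x v = scale \<delta> v}"

definition ad_eigenvalue ::
  "('f::field \<Rightarrow> 'g::ab_group_add \<Rightarrow> 'g) \<Rightarrow> ('g \<Rightarrow> 'g \<Rightarrow> 'g) \<Rightarrow> 'g set \<Rightarrow> 'g \<Rightarrow> 'f \<Rightarrow> bool" where
  "ad_eigenvalue scale bracket A x \<delta> \<longleftrightarrow> (\<exists>v \<in> ad_eigenspace scale bracket A x \<delta>. v \<noteq> 0)"

definition acts_trivially :: "('g \<Rightarrow> 'u \<Rightarrow> 'u::zero) \<Rightarrow> 'g set \<Rightarrow> bool" where
  "acts_trivially act S \<longleftrightarrow> (\<forall>y\<in>S. \<forall>u. act y u = 0)"

definition faithful_action :: "('g::zero \<Rightarrow> 'u \<Rightarrow> 'u::zero) \<Rightarrow> bool" where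
  "faithful_action act \<longleftrightarrow> (\<forall>y. (\<forall>u. act y u = 0) \<longrightarrow> y = 0)"

definition admissible ::
  "('f::field \<Rightarrow> 'g::ab_group_add \<Rightarrow> 'g) \<Rightarrow> ('g \<Rightarrow> 'g \<Rightarrow> 'g) \<Rightarrow> ('g \<Rightarrow> 'u \<Rightarrow> 'u::zero) \<Rightarrow> bool" where
  "admissible scale bracket act \<longleftrightarrow>
     (\<forall>y \<in> derived_algebra scale bracket. \<exists>n. \<forall>u. (act y ^^ n) u = 0)"

definition submodule ::
  "('f::field \<Rightarrow> 'u::ab_group_add \<Rightarrow> 'u) \<Rightarrow> ('g \<Rightarrow> 'u \<Rightarrow> 'u) \<Rightarrow> 'u set \<Rightarrow> bool" where
  "submodule uscale act W \<longleftrightarrow> module.subspace uscale W \<and> (\<forall>y. \<forall>w\<in>W. act y w \<in> W)"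

text \<open>A factor \<open>Ws ! Suc k / Ws ! k\<close> is irreducible iff the inclusion is proper and no submodule
  lies strictly in between.\<close>

definition composition_series ::
  "('f::field \<Rightarrow> 'u::ab_group_add \<Rightarrow> 'u) \<Rightarrow> ('g \<Rightarrow> 'u \<Rightarrow> 'u) \<Rightarrow> 'u set list \<Rightarrow> bool" where
  "composition_series uscale act Ws \<longleftrightarrow>
     Ws \<noteq> [] \<and> hd Ws = {0} \<and> last Ws = UNIV \<and> (\<forall>W \<in> set Ws. submodule uscale act W)
     \<and> (\<forall>k. Suc k < length Ws \<longrightarrow> Ws ! k \<subset> Ws ! Suc k
          \<and> (\<forall>W. submodule uscale act W \<and> Ws ! k \<subseteq> W \<and> W \<subseteq> Ws ! Suc k
                \<longrightarrow> W = Ws ! k \<or> W = Ws ! Suc k))"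

definition has_composition_length ::
  "('f::field \<Rightarrow> 'u::ab_group_add \<Rightarrow> 'u) \<Rightarrow> ('g \<Rightarrow> 'u \<Rightarrow> 'u) \<Rightarrow> nat \<Rightarrow> bool" where
  "has_composition_length uscale act m \<longleftrightarrow>
     (\<exists>Ws. composition_series uscale act Ws \<and> length Ws = Suc m)"

definition uniserial ::
  "('f::field \<Rightarrow> 'u::ab_group_add \<Rightarrow> 'u) \<Rightarrow> ('g \<Rightarrow> 'u \<Rightarrow> 'u) \<Rightarrow> bool" where
  "uniserial uscale act \<longleftrightarrow> (\<exists>!Ws. composition_series uscale act Ws)"

definition nontrivial_eigenvalues ::
  "('f::field \<Rightarrow> 'g::ab_group_add \<Rightarrow> 'g) \<Rightarrow> ('g \<Rightarrow> 'g \<Rightarrow> 'g) \<Rightarrow> ('g \<Rightarrow> 'u \<Rightarrow> 'u::zero)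
     \<Rightarrow> 'g set \<Rightarrow> 'g \<Rightarrow> 'f set" where
  "nontrivial_eigenvalues scale bracket act A x =
     {\<delta>. ad_eigenvalue scale bracket A x \<delta>
        \<and> \<not> acts_trivially act (ad_eigenspace scale bracket A x \<delta>)}"

definition is_subfield :: "'f::field set \<Rightarrow> bool" where
  "is_subfield K \<longleftrightarrow> 0 \<in> K \<and> 1 \<in> K
     \<and> (\<forall>a\<in>K. \<forall>b\<in>K. a + b \<in> K \<and> a * b \<in> K) \<and> (\<forall>a\<in>K. - a \<in> K \<and> inverse a \<in> K)"

definition prime_subfield :: "'f::field set" where
  "prime_subfield = \<Inter>{K. is_subfield K}"

section \<open>Matrices\<close>

definition poly_mat :: "'f::field poly \<Rightarrow> 'f mat \<Rightarrow> 'f mat" where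
  "poly_mat h A = mat (dim_row A) (dim_row A)
     (\<lambda>(r, s). \<Sum>k\<le>degree h. coeff h k * (A ^\<^sub>m k) $$ (r, s))"

abbreviation J_mat :: "nat \<Rightarrow> 'f::field mat" where
  "J_mat m \<equiv> jordan_block m 0"

text \<open>\<open>FJ p m i\<close> is \<open>F[J\<^sup>p]J\<^sup>i\<close> for the nilpotent Jordan block \<open>J\<close> of size \<open>m\<close>.\<close>

definition FJ :: "nat \<Rightarrow> nat \<Rightarrow> nat \<Rightarrow> 'f::field mat set" where
  "FJ p m i = {poly_mat h (J_mat m ^\<^sub>m p) * J_mat m ^\<^sub>m i |h. True}"

definition D_mat :: "nat \<Rightarrow> 'f::field \<Rightarrow> 'f mat" where
  "D_mat m \<alpha> = mat_diag m (\<lambda>k. \<alpha> - of_nat k)"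

definition mat_linear_on ::
  "('f::field \<Rightarrow> 'g::ab_group_add \<Rightarrow> 'g) \<Rightarrow> 'g set \<Rightarrow> ('g \<Rightarrow> 'f mat) \<Rightarrow> bool" where
  "mat_linear_on scale V g \<longleftrightarrow>
     (\<forall>u\<in>V. \<forall>w\<in>V. g (u + w) = g u + g w) \<and> (\<forall>c. \<forall>u\<in>V. g (scale c u) = c \<cdot>\<^sub>m g u)"

definition ordered_basis :: "('f::field \<Rightarrow> 'u::ab_group_add \<Rightarrow> 'u) \<Rightarrow> 'u list \<Rightarrow> bool" where
  "ordered_basis uscale es \<longleftrightarrow>
     distinct es \<and> \<not> module.dependent uscale (set es) \<and> module.span uscale (set es) = UNIV"

text \<open>Column convention: column \<open>j\<close> of \<open>T\<close> lists the coordinates of \<open>f (es ! j)\<close>.\<close>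

definition represented_by ::
  "('f::field \<Rightarrow> 'u::ab_group_add \<Rightarrow> 'u) \<Rightarrow> 'u list \<Rightarrow> ('u \<Rightarrow> 'u) \<Rightarrow> 'f mat \<Rightarrow> bool" where
  "represented_by uscale es f T \<longleftrightarrow> T \<in> carrier_mat (length es) (length es)
     \<and> (\<forall>j < length es. f (es ! j) = (\<Sum>k<length es. uscale (T $$ (k, j)) (es ! k)))"

text \<open>The matrix form of the module, for a given \<open>v\<close> of eigenvalue \<open>1\<close>. The representing matrix of
  \<open>x\<close> is taken in \<open>D + F[J\<^sup>p]J\<^sup>p\<close>, not in \<open>D + F[J\<^sup>p]J\<close>: relative to a basis in which \<open>v\<close> is
  represented by \<open>J\<close>, conjugation by units of \<open>F[J]\<close> removes from \<open>x - D\<close> every power of \<open>J\<close> whose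
  exponent is prime to \<open>p\<close>, but in general not the powers of \<open>J\<^sup>p\<close>. For instance
  (\<open>p = 2\<close>, \<open>m = 5\<close>), if \<open>x\<close> acts as \<open>D + J\<^sup>2\<close> and \<open>v\<close> as \<open>J\<close>, then
  \<open>x\<^sup>2 - x = const + v\<^sup>2 + v\<^sup>4\<close>, whereas \<open>Y\<^sup>2 - Y = const + a\<^sup>2 J\<^sup>2\<close> for
  \<open>Y = D + a J + b J\<^sup>3\<close>.\<close>

definition has_matrix_form ::
  "('f::field \<Rightarrow> 'g::ab_group_add \<Rightarrow> 'g) \<Rightarrow> ('g \<Rightarrow> 'g \<Rightarrow> 'g) \<Rightarrow> ('f \<Rightarrow> 'u::ab_group_add \<Rightarrow> 'u)
     \<Rightarrow> ('g \<Rightarrow> 'u \<Rightarrow> 'u) \<Rightarrow> 'g set \<Rightarrow> 'g \<Rightarrow> nat \<Rightarrow> nat \<Rightarrow> 'g \<Rightarrow> bool" where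
  "has_matrix_form scale bracket uscale act A x p m v \<longleftrightarrow>
     (\<exists>(g :: nat \<Rightarrow> 'g \<Rightarrow> 'f mat) \<alpha> Y es.
        (\<forall>i<p. mat_linear_on scale (ad_eigenspace scale bracket A x (of_nat i)) (g i)
             \<and> (\<forall>u \<in> ad_eigenspace scale bracket A x (of_nat i). g i u \<in> FJ p m i))
        \<and> g 1 v = J_mat m
        \<and> Y \<in> {D_mat m \<alpha> + N |N. N \<in> FJ p m p}
        \<and> ordered_basis uscale es \<and> length es = m
        \<and> represented_by uscale es (act x) Y
        \<and> (\<forall>i<p. \<forall>u \<in> ad_eigenspace scale bracket A x (of_nat i).
             represented_by uscale es (act u) (g i u)))"

end

theory Submission
  imports Defs "HOL-Number_Theory.Cong"
begin

text \<open>
  The composition factors are lines. Indeed, for consecutive submodules \<open>W \<subset> W'\<close> the vectors of \<open>W'\<close> that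
  an eigenvector of \<open>ad x\<close> with non-zero eigenvalue sends into \<open>W\<close> form a submodule, which is larger
  than \<open>W\<close> by nilpotency and so is all of \<open>W'\<close>; then \<open>x\<close> and the central part of \<open>A\<close> have eigenvectors
  modulo \<open>W\<close> whose eigenspaces are submodules, and act by scalars. Thus \<open>U\<close> has a full flag
  \<open>W 0 \<subset> \<dots> \<subset> W m\<close>, which by uniseriality contains every submodule, and \<open>x\<close> has a weight on
  each factor (\<open>covers_line\<close>, \<open>submodule_is_W\<close>, \<open>dim_UNIV\<close>).

  An eigenvector of \<open>ad x\<close> in \<open>A\<close> of eigenvalue \<open>\<delta>\<close> maps submodules to submodules, so it moves the flag
  along itself, and \<open>\<delta>\<close> is a difference of weights (\<open>weight_shift\<close>, \<open>weight_is_difference\<close>). If no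
  eigenvector of non-zero eigenvalue moved the flag by exactly one step, either a central element
  shifted by a scalar would do so, or \<open>x\<close> itself would have to glue adjacent factors; in both cases all weights are equal and
  \<open>[g, g]\<close> acts by zero (\<open>non_central_jordan_vector_exists\<close>). So after rescaling \<open>x\<close> there is an
  eigenvector \<open>v\<close> of eigenvalue \<open>1\<close> with \<open>v\<^sup>m\<^sup>-\<^sup>1 \<noteq> 0\<close>. The weights are then consecutive, hence all
  eigenvalues that act are integers in \<open>F\<close>.

  For any such \<open>v\<close> a vector \<open>w\<close> outside the kernel of \<open>v\<^sup>m\<^sup>-\<^sup>1\<close> is cyclic for \<open>v\<close>, and \<open>v\<close> is a Jordan block in
  the basis of the \<open>v\<^sup>n w\<close>. The elements of \<open>A\<close> commute with \<open>v\<close>, so they are polynomials in \<open>v\<close>, and the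
  commutator with \<open>x\<close> acts on these as \<open>v d/dv\<close>: eigenvalue \<open>i\<close> leaves only the exponents congruent to
  \<open>i\<close> modulo \<open>p\<close> (\<open>E_exponents\<close>). Counting these exponents bounds the multiplicity when the action is
  faithful (\<open>multiplicity_le\<close>). Finally \<open>x w = f(v) w\<close>, and replacing \<open>w\<close> by \<open>u(v) w\<close> for a unit
  \<open>u(v)\<close> adds \<open>v u'(v) / u(v)\<close> to \<open>f(v)\<close>. Factors \<open>1 + c v\<^sup>n\<close> with \<open>p\<close> not dividing \<open>n\<close> remove the unwanted
  exponents one after the other (\<open>normalized_cyclic_vector_mod\<close>), which yields the matrix of \<open>x\<close>.
\<close>

section \<open>Eigenvalues modulo an invariant subspace\<close>

locale operator_space = finite_dimensional_vector_space scale Basis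
  for scale :: "'a::field \<Rightarrow> 'b::ab_group_add \<Rightarrow> 'b" and Basis :: "'b set"
begin

definition poly_op :: "('b \<Rightarrow> 'b) \<Rightarrow> 'a poly \<Rightarrow> 'b \<Rightarrow> 'b" where
  "poly_op T P u = (\<Sum>k\<le>degree P. scale (coeff P k) ((T ^^ k) u))"

lemma poly_op_bound:
  fixes P :: "'a poly"
  assumes "degree P \<le> n"
  shows "poly_op T P u = (\<Sum>k\<le>n. scale (coeff P k) ((T ^^ k) u))"
  unfolding poly_op_def
  by (rule sum.mono_neutral_left) (use assms in \<open>auto simp: coeff_eq_0\<close>)

lemma poly_op_root_factor:
  fixes Q :: "'a poly"
  assumes T: "Vector_Spaces.linear scale scale T"
  shows "poly_op T ([:- c, 1:] * Q) u = T (poly_op T Q u) - scale c (poly_op T Q u)"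
proof -
  interpret T: Vector_Spaces.linear scale scale T by (fact T)
  let ?n = "degree Q"
  have T_sum: "T (poly_op T Q u) = (\<Sum>k\<le>?n. scale (coeff Q k) ((T ^^ Suc k) u))"
    by (simp add: poly_op_def T.sum T.scale)
  have c_sum: "scale c (poly_op T Q u) = (\<Sum>k\<le>Suc ?n. scale (c * coeff Q k) ((T ^^ k) u))"
    using poly_op_bound[of Q "Suc ?n" T u] by (simp add: scale_sum_right scale_right_distrib coeff_eq_0)
  have "degree ([:- c, 1:] * Q) \<le> Suc ?n"
    using degree_mult_le[of "[:- c, 1:]" Q] by simp
  then have "poly_op T ([:- c, 1:] * Q) u
      = (\<Sum>k\<le>Suc ?n. scale (coeff ([:- c, 1:] * Q) k) ((T ^^ k) u))"
    by (rule poly_op_bound)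
  also have "\<dots> = (\<Sum>k\<le>Suc ?n. scale (coeff (pCons 0 Q) k) ((T ^^ k) u)
      - scale (c * coeff Q k) ((T ^^ k) u))"
    by (rule sum.cong) (simp_all add: scale_left_diff_distrib)
  also have "\<dots> = (\<Sum>k\<le>Suc ?n. scale (coeff (pCons 0 Q) k) ((T ^^ k) u))
      - scale c (poly_op T Q u)"
    by (simp add: sum_subtractf c_sum)
  also have "(\<Sum>k\<le>Suc ?n. scale (coeff (pCons 0 Q) k) ((T ^^ k) u))
      = (\<Sum>k\<le>?n. scale (coeff Q k) ((T ^^ Suc k) u))"
    by (subst sum.atMost_Suc_shift) simp
  finally show ?thesis by (simp add: T_sum)
qed

lemma funpow_closed:
  assumes "\<And>u. u \<in> W \<Longrightarrow> T u \<in> W" and "w \<in> W"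
  shows "(T ^^ k) w \<in> W"
  by (induction k) (use assms in auto)

lemma poly_op_closed:
  assumes "subspace W" and "\<And>u. u \<in> W \<Longrightarrow> T u \<in> W" and "w \<in> W"
  shows "poly_op T P w \<in> W"
  unfolding poly_op_def
  by (intro subspace_sum subspace_scale assms(1) funpow_closed[where W = W]) (use assms in auto)

text \<open>The iterates of \<open>T\<close> on a vector cannot all be linearly independent, and the first dependence
  among them is a polynomial relation with leading coefficient \<open>1\<close>.\<close>

lemma annihilating_poly_exists:
  obtains P where "P \<noteq> 0" and "poly_op T P w = 0"
proof -
  have "\<exists>k. (T ^^ k) w \<in> span ((\<lambda>j. (T ^^ j) w) ` {..<k})"
  proof (rule ccontr)
    assume no: "\<not> ?thesis"
    have indep: "independent ((\<lambda>j. (T ^^ j) w) ` {..<k}) \<and> card ((\<lambda>j. (T ^^ j) w) ` {..<k}) = k" for k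
    proof (induction k)
      case (Suc k)
      from no have out: "(T ^^ k) w \<notin> span ((\<lambda>j. (T ^^ j) w) ` {..<k})" by blast
      then have notin: "(T ^^ k) w \<notin> (\<lambda>j. (T ^^ j) w) ` {..<k}" by (rule contra_subsetD[OF span_superset])
      have "(\<lambda>j. (T ^^ j) w) ` {..<Suc k} = insert ((T ^^ k) w) ((\<lambda>j. (T ^^ j) w) ` {..<k})"
        by (simp add: lessThan_Suc)
      moreover have "card (insert ((T ^^ k) w) ((\<lambda>j. (T ^^ j) w) ` {..<k})) = Suc k"
        using Suc notin by (subst card_insert_disjoint) auto
      ultimately show ?case using Suc out independent_insertI by metis
    qed (simp add: independent_empty)
    from indep[of "Suc dimension"] show False
      using independent_card_le_dim[of "(\<lambda>j. (T ^^ j) w) ` {..<Suc dimension}" UNIV] dim_UNIV by (auto simp: dimension_def)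
  qed
  then obtain k where k: "(T ^^ k) w \<in> span ((\<lambda>j. (T ^^ j) w) ` {..<k})" ..
  define R where "R = {u. \<exists>c. u = (\<Sum>j<k. scale (c j) ((T ^^ j) w))}"
  have "subspace R"
  proof (rule subspaceI)
    show "0 \<in> R" unfolding R_def by (auto intro!: exI[of _ "\<lambda>_. 0"])
  next
    fix u v assume "u \<in> R" "v \<in> R"
    then obtain c d where "u = (\<Sum>j<k. scale (c j) ((T ^^ j) w))" "v = (\<Sum>j<k. scale (d j) ((T ^^ j) w))"
      unfolding R_def by auto
    then have "u + v = (\<Sum>j<k. scale (c j + d j) ((T ^^ j) w))"
      by (simp add: scale_left_distrib sum.distrib)
    then show "u + v \<in> R" unfolding R_def by (auto intro: exI[of _ "\<lambda>j. c j + d j"])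
  next
    fix a u assume "u \<in> R"
    then obtain c where "u = (\<Sum>j<k. scale (c j) ((T ^^ j) w))" unfolding R_def by auto
    then have "scale a u = (\<Sum>j<k. scale (a * c j) ((T ^^ j) w))" by (simp add: scale_sum_right)
    then show "scale a u \<in> R" unfolding R_def by (auto intro: exI[of _ "\<lambda>j. a * c j"])
  qed
  moreover have "(T ^^ j) w \<in> R" if "j < k" for j
  proof -
    have "(T ^^ j) w = (\<Sum>i<k. scale (if i = j then 1 else 0) ((T ^^ i) w))"
      using that by (simp add: if_distrib[of "\<lambda>c. scale c _"] cong: if_cong)
    then show ?thesis unfolding R_def by (auto intro: exI[of _ "\<lambda>i. if i = j then 1 else 0"])
  qed
  ultimately have "span ((\<lambda>j. (T ^^ j) w) ` {..<k}) \<subseteq> R"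
    by (intro span_minimal) auto
  with k obtain c where c: "(T ^^ k) w = (\<Sum>j<k. scale (c j) ((T ^^ j) w))" unfolding R_def by auto
  define P where "P = monom 1 k - (\<Sum>j<k. monom (c j) j)"
  have coeff: "coeff P i = (if i = k then 1 else if i < k then - c i else 0)" for i
    by (auto simp: P_def coeff_sum)
  then have "degree P \<le> k" by (intro degree_le) auto
  then have "poly_op T P w = (\<Sum>i\<le>k. scale (coeff P i) ((T ^^ i) w))" by (rule poly_op_bound)
  also have "\<dots> = (\<Sum>i<k. scale (- c i) ((T ^^ i) w)) + (T ^^ k) w"
    by (simp add: lessThan_Suc_atMost[symmetric] coeff)
  also have "\<dots> = 0" by (subst c) (simp add: sum_negf)
  finally have "poly_op T P w = 0" .
  moreover have "P \<noteq> 0" using coeff[of k] by auto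
  ultimately show ?thesis using that by blast
qed

end

text \<open>Applied to a vector outside \<open>W\<close>, the linear factors of an annihilating polynomial must at some
  stage carry a vector outside \<open>W\<close> into \<open>W\<close>; that vector is an eigenvector modulo \<open>W\<close>.\<close>

lemma eigenvector_mod_of_annihilating_poly:
  fixes scale :: "'a::alg_closed_field \<Rightarrow> 'b::ab_group_add \<Rightarrow> 'b" and P :: "'a poly"
  assumes space: "operator_space scale Basis"
    and T: "Vector_Spaces.linear scale scale T"
    and W: "module.subspace scale W" and W': "module.subspace scale W'" and T': "\<And>u. u \<in> W' \<Longrightarrow> T u \<in> W'"
    and w: "w \<in> W'" "w \<notin> W"
  shows "P \<noteq> 0 \<Longrightarrow> operator_space.poly_op scale T P w \<in> W
    \<Longrightarrow> \<exists>c. \<exists>u \<in> W'. u \<notin> W \<and> T u - scale c u \<in> W"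
proof -
  interpret operator_space scale Basis by (fact space)
  show "P \<noteq> 0 \<Longrightarrow> poly_op T P w \<in> W
    \<Longrightarrow> \<exists>c. \<exists>u \<in> W'. u \<notin> W \<and> T u - scale c u \<in> W"
  proof (induction "degree P" arbitrary: P)
    case 0
    from 0(1) obtain a where P: "P = [:a:]" by (metis degree_eq_zeroE)
    with 0(2,3) have "a \<noteq> 0" "scale a w \<in> W" by (auto simp: poly_op_def)
    then have "scale (inverse a) (scale a w) \<in> W" using W subspace_scale by blast
    with \<open>a \<noteq> 0\<close> w show ?case by simp
  next
    case (Suc n)
    then have "degree P > 0" by simp
    then obtain c where "poly P c = 0" using alg_closed_imp_poly_has_root by blast
    then obtain Q where Q: "P = [:- c, 1:] * Q" using poly_eq_0_iff_dvd[of P c] by (auto elim: dvdE)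
    with Suc(3) have "Q \<noteq> 0" by auto
    then have deg: "n = degree Q" using Suc(2) Q degree_mult_eq[of "[:- c, 1:]" Q] by simp
    show ?case
    proof (cases "poly_op T Q w \<in> W")
      case True
      then show ?thesis using Suc(1)[OF deg \<open>Q \<noteq> 0\<close>] by blast
    next
      case False
      moreover have "poly_op T Q w \<in> W'" using poly_op_closed[OF W' T' w(1)] .
      ultimately show ?thesis using Suc(4) poly_op_root_factor[OF T, of c Q w] Q by auto
    qed
  qed
qed

lemma eigenvector_mod:
  fixes scale :: "'a::alg_closed_field \<Rightarrow> 'b::ab_group_add \<Rightarrow> 'b"
  assumes fd: "finite_dimensional_vector_space scale Basis"
    and T: "Vector_Spaces.linear scale scale T"
    and W: "module.subspace scale W" and W': "module.subspace scale W'"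
    and T': "\<And>u. u \<in> W' \<Longrightarrow> T u \<in> W'" and w: "w \<in> W'" "w \<notin> W"
  obtains c u where "u \<in> W'" "u \<notin> W" "T u - scale c u \<in> W"
proof -
  interpret operator_space scale Basis
    using fd by (simp add: operator_space_def)
  obtain P where "P \<noteq> 0" "poly_op T P w = 0" using annihilating_poly_exists .
  with eigenvector_mod_of_annihilating_poly[OF operator_space_axioms T W W' T' w, of P] subspace_0[OF W] that
  show ?thesis by auto
qed

lemma (in vector_space) subspace_plus_line:
  assumes W: "subspace W"
  shows "subspace {u. \<exists>c. u - scale c e \<in> W}"
proof (rule subspaceI)
  show "0 \<in> {u. \<exists>c. u - scale c e \<in> W}"
    using subspace_0[OF W] by (auto intro!: exI[of _ 0])
next
  fix u v assume "u \<in> {u. \<exists>c. u - scale c e \<in> W}" "v \<in> {u. \<exists>c. u - scale c e \<in> W}"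
  then obtain c d where "u - scale c e \<in> W" "v - scale d e \<in> W" by blast
  then have "(u - scale c e) + (v - scale d e) \<in> W" by (rule subspace_add[OF W])
  moreover have "(u - scale c e) + (v - scale d e) = (u + v) - scale (c + d) e"
    by (simp add: scale_left_distrib)
  ultimately show "u + v \<in> {u. \<exists>c. u - scale c e \<in> W}" by auto
next
  fix a u assume "u \<in> {u. \<exists>c. u - scale c e \<in> W}"
  then obtain c where "u - scale c e \<in> W" by blast
  then have "scale a (u - scale c e) \<in> W" by (rule subspace_scale[OF W])
  moreover have "scale a (u - scale c e) = scale a u - scale (a * c) e"
    by (simp add: scale_right_diff_distrib)
  ultimately show "scale a u \<in> {u. \<exists>c. u - scale c e \<in> W}" by auto
qed

section \<open>Submodules and composition series\<close>

locale line_extension = lie_module scale bracket uscale act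
  for scale :: "'f::alg_closed_field \<Rightarrow> 'g::ab_group_add \<Rightarrow> 'g"
    and bracket :: "'g \<Rightarrow> 'g \<Rightarrow> 'g"
    and uscale :: "'f \<Rightarrow> 'u::ab_group_add \<Rightarrow> 'u"
    and act :: "'g \<Rightarrow> 'u \<Rightarrow> 'u" +
  fixes x :: 'g and A :: "'g set"
  assumes ideal: "abelian_ideal scale bracket A"
    and complement: "line_complement scale x A"
    and diagonalizable: "ad_diagonalizable_on scale bracket x A"
    and admissible: "admissible scale bracket act"
begin

abbreviation E :: "'f \<Rightarrow> 'g set" where
  "E \<delta> \<equiv> ad_eigenspace scale bracket A x \<delta>"

abbreviation smod :: "'u set \<Rightarrow> bool" where
  "smod \<equiv> submodule uscale act"

lemma
  act_add: "act y (u + w) = act y u + act y w" and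
  act_diff: "act y (u - w) = act y u - act y w" and
  act_zero: "act y 0 = 0" and
  act_uscale: "act y (uscale c u) = uscale c (act y u)" and
  act_sum: "act y (sum f I) = (\<Sum>i\<in>I. act y (f i))"
proof -
  interpret a: Vector_Spaces.linear uscale uscale "act y" by (rule act_linear_right)
  show "act y (u + w) = act y u + act y w" "act y (u - w) = act y u - act y w"
    "act y 0 = 0" "act y (uscale c u) = uscale c (act y u)" "act y (sum f I) = (\<Sum>i\<in>I. act y (f i))"
    by (rule a.add a.diff a.zero a.scale a.sum)+
qed

lemma
  act_add_left: "act (y + z) u = act y u + act z u" and
  act_zero_left: "act 0 u = 0" and
  act_scale_left: "act (scale c y) u = uscale c (act y u)"
proof -
  interpret a: Vector_Spaces.linear scale uscale "\<lambda>y. act y u" by (rule act_linear_left)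
  show "act (y + z) u = act y u + act z u" "act 0 u = 0" "act (scale c y) u = uscale c (act y u)"
    by (rule a.add a.zero a.scale)+
qed

lemma
  bracket_add: "bracket y (z + w) = bracket y z + bracket y w" and
  bracket_zero: "bracket y 0 = 0" and
  bracket_scale: "bracket y (scale c z) = scale c (bracket y z)"
proof -
  interpret a: Vector_Spaces.linear scale scale "\<lambda>z. bracket y z" by (rule bracket_linear_right)
  show "bracket y (z + w) = bracket y z + bracket y w" "bracket y 0 = 0"
    "bracket y (scale c z) = scale c (bracket y z)"
    by (rule a.add a.zero a.scale)+
qed

lemma bracket_antisym: "bracket y z = - bracket z y"
proof -
  interpret a: Vector_Spaces.linear scale scale "\<lambda>y. bracket y w" for w by (rule bracket_linear_left)
  have "0 = bracket (y + z) (z + y)" using bracket_self[of "y + z"] by (simp add: add.commute)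
  also have "\<dots> = bracket y z + bracket z y" by (simp only: a.add bracket_add bracket_self add_0_left add_0_right)
  finally show ?thesis by (simp add: eq_neg_iff_add_eq_0)
qed

lemma subspace_A: "subspace A"
  and bracket_A_A: "a \<in> A \<Longrightarrow> b \<in> A \<Longrightarrow> bracket a b = 0"
  using ideal by (auto simp: abelian_ideal_def)

lemma E_in_A: "a \<in> E \<delta> \<Longrightarrow> a \<in> A"
  by (simp add: ad_eigenspace_def)

lemma subspace_E: "subspace (E \<delta>)"
  using subspace_A
  by (auto simp: subspace_def ad_eigenspace_def bracket_add bracket_zero bracket_scale
        scale_right_distrib mult.commute)

lemma act_A_commute: "a \<in> A \<Longrightarrow> b \<in> A \<Longrightarrow> act a (act b u) = act b (act a u)"
  using act_bracket[of a b u] by (simp add: bracket_A_A act_zero_left)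

lemma act_x_E: "a \<in> E \<delta> \<Longrightarrow> act x (act a u) = act a (act x u) + uscale \<delta> (act a u)"
  using act_bracket[of x a u] by (simp add: ad_eigenspace_def act_scale_left algebra_simps)

text \<open>\<open>A\<close> is spanned by eigenvectors of \<open>ad x\<close>, so a linear condition on \<open>A\<close> need only be checked
  on eigenvectors.\<close>

lemma A_induct:
  assumes P: "subspace {y. P y}" and E: "\<And>\<delta> a. a \<in> E \<delta> \<Longrightarrow> P a" and a: "a \<in> A"
  shows "P a"
proof -
  obtain B where B: "B \<subseteq> A" "span B = A" "\<forall>b\<in>B. \<exists>\<delta>. bracket x b = scale \<delta> b"
    using diagonalizable unfolding ad_diagonalizable_on_def by blast
  have "B \<subseteq> {y. P y}" using B(1,3) E unfolding ad_eigenspace_def by blast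
  then have "span B \<subseteq> {y. P y}" using P by (rule span_minimal)
  with B(2) a show ?thesis by blast
qed

lemma g_induct:
  assumes P: "subspace {y. P y}" and x: "P x" and A: "\<And>a. a \<in> A \<Longrightarrow> P a"
  shows "P y"
proof -
  have "y \<in> {s + a |s a. s \<in> span {x} \<and> a \<in> A}"
    using complement unfolding line_complement_def by blast
  then obtain s a where y: "y = s + a" "s \<in> span {x}" "a \<in> A" by blast
  have "span {x} \<subseteq> {y. P y}" using x P by (intro span_minimal) auto
  then show ?thesis using y A P subspace_add[of "{y. P y}" s a] by blast
qed

lemma submodule_iff:
  "smod W \<longleftrightarrow> U.subspace W \<and> (\<forall>w\<in>W. act x w \<in> W) \<and> (\<forall>a\<in>A. \<forall>w\<in>W. act a w \<in> W)"
proof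
  assume R: "U.subspace W \<and> (\<forall>w\<in>W. act x w \<in> W) \<and> (\<forall>a\<in>A. \<forall>w\<in>W. act a w \<in> W)"
  then have "subspace {y. \<forall>w\<in>W. act y w \<in> W}"
    by (auto simp: subspace_def act_zero_left act_add_left act_scale_left
        intro: U.subspace_0 U.subspace_add U.subspace_scale)
  then have "\<forall>w\<in>W. act y w \<in> W" for y
    by (rule g_induct) (use R in auto)
  with R show "smod W" by (simp add: submodule_def)
qed (simp add: submodule_def)

lemma submoduleI:
  assumes W: "U.subspace W" and x: "\<And>w. w \<in> W \<Longrightarrow> act x w \<in> W"
    and E: "\<And>\<delta> a w. a \<in> E \<delta> \<Longrightarrow> w \<in> W \<Longrightarrow> act a w \<in> W"
  shows "smod W"
  unfolding submodule_iff
proof (intro conjI ballI W x)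
  fix a w assume "a \<in> A" and w: "w \<in> W"
  have "subspace {a. act a w \<in> W}"
    using W by (auto simp: subspace_def act_zero_left act_add_left act_scale_left
        U.subspace_0 U.subspace_add U.subspace_scale)
  then show "act a w \<in> W" by (rule A_induct) (use E w \<open>a \<in> A\<close> in auto)
qed

lemma submodule_subspace: "smod W \<Longrightarrow> U.subspace W"
  and submodule_act: "smod W \<Longrightarrow> w \<in> W \<Longrightarrow> act y w \<in> W"
  by (auto simp: submodule_def)

lemma submodule_zero: "smod {0}" and submodule_UNIV: "smod UNIV"
  by (auto simp: submodule_def act_zero U.subspace_single_0)

definition covers :: "'u set \<Rightarrow> 'u set \<Rightarrow> bool" where
  "covers W W' \<longleftrightarrow> W \<subset> W' \<and> (\<forall>N. smod N \<and> W \<subseteq> N \<and> N \<subseteq> W' \<longrightarrow> N = W \<or> N = W')"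

lemma composition_series_iff:
  "composition_series uscale act Ws \<longleftrightarrow> Ws \<noteq> [] \<and> hd Ws = {0} \<and> last Ws = UNIV
     \<and> (\<forall>W \<in> set Ws. smod W) \<and> successively covers Ws"
  by (simp add: composition_series_def successively_conv_nth covers_def)

text \<open>Inserting intermediate submodules between \<open>M\<close> and \<open>N\<close> stops because dimensions are finite.\<close>

lemma refinement_exists:
  assumes fd: "finite_dimensional_vector_space uscale Basis"
  shows "smod M \<Longrightarrow> smod N \<Longrightarrow> M \<subseteq> N \<Longrightarrow>
    \<exists>Ws. Ws \<noteq> [] \<and> hd Ws = M \<and> last Ws = N \<and> (\<forall>W \<in> set Ws. smod W) \<and> successively covers Ws"
proof -
  interpret F: finite_dimensional_vector_space uscale Basis by (fact fd)
  have dim_less: "U.dim P < U.dim Q" if "smod P" "smod Q" "P \<subset> Q" for P Q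
    using F.subspace_dim_equal[of P Q] F.dim_subset[of P Q] that submodule_subspace by fastforce
  show "smod M \<Longrightarrow> smod N \<Longrightarrow> M \<subseteq> N \<Longrightarrow> ?thesis"
  proof (induction "U.dim N - U.dim M" arbitrary: M N rule: less_induct)
    case less
    consider "M = N" | "covers M N" | K where "smod K" "M \<subset> K" "K \<subset> N"
      using less.prems unfolding covers_def by blast
    then show ?case
    proof cases
      case 1
      then show ?thesis using less.prems by (intro exI[of _ "[M]"]) auto
    next
      case 2
      then show ?thesis using less.prems by (intro exI[of _ "[M, N]"]) auto
    next
      case 3
      from dim_less[OF less.prems(1) 3(1,2)] dim_less[OF 3(1) less.prems(2) 3(3)]
      have dims: "U.dim K - U.dim M < U.dim N - U.dim M" "U.dim N - U.dim K < U.dim N - U.dim M"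
        by linarith+
      from 3 have sub: "M \<subseteq> K" "K \<subseteq> N" by auto
      obtain Vs where Vs: "Vs \<noteq> []" "hd Vs = M" "last Vs = K" "\<forall>W \<in> set Vs. smod W"
          "successively covers Vs"
        using less.hyps[OF dims(1) less.prems(1) 3(1) sub(1)] by blast
      obtain Ws where Ws: "Ws \<noteq> []" "hd Ws = K" "last Ws = N" "\<forall>W \<in> set Ws. smod W"
          "successively covers Ws"
        using less.hyps[OF dims(2) 3(1) less.prems(2) sub(2)] by blast
      from Ws obtain Ws' where Ws': "Ws = K # Ws'" by (cases Ws) auto
      with Ws(3) 3(3) have "Ws' \<noteq> []" by auto
      have "successively covers (Vs @ Ws')"
        using Vs Ws Ws' \<open>Ws' \<noteq> []\<close> by (auto simp: successively_append_iff successively_Cons)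
      then show ?thesis using Vs Ws Ws' \<open>Ws' \<noteq> []\<close>
        by (intro exI[of _ "Vs @ Ws'"]) auto
    qed
  qed
qed

text \<open>A composition series can be made to pass through any given submodule, so in a uniserial module
  every submodule occurs in the unique series.\<close>

lemma uniserial_submodule_in_series:
  assumes fd: "finite_dimensional_vector_space uscale Basis" and uni: "uniserial uscale act"
    and Ws: "composition_series uscale act Ws" and N: "smod N"
  shows "N \<in> set Ws"
proof -
  obtain Vs where Vs: "Vs \<noteq> []" "hd Vs = {0}" "last Vs = N" "\<forall>W \<in> set Vs. smod W"
      "successively covers Vs"
    using refinement_exists[OF fd submodule_zero N] U.subspace_0[OF submodule_subspace[OF N]] by auto
  obtain Us where Us: "Us \<noteq> []" "hd Us = N" "last Us = UNIV" "\<forall>W \<in> set Us. smod W"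
      "successively covers Us"
    using refinement_exists[OF fd N submodule_UNIV] by auto
  from Us obtain Us' where Us': "Us = N # Us'" by (cases Us) auto
  have "composition_series uscale act (Vs @ Us')"
    using Vs Us Us' unfolding composition_series_iff
    by (cases "Us' = []") (auto simp: successively_append_iff successively_Cons)
  then have "Ws = Vs @ Us'" using uni Ws unfolding uniserial_def by blast
  then show ?thesis using Vs(1,3) by auto
qed

section \<open>Composition factors are lines\<close>

text \<open>The vectors of \<open>W'\<close> that \<open>T\<close> sends into \<open>W\<close> form a subspace between \<open>W\<close> and \<open>W'\<close>; as soon as
  it is a submodule larger than \<open>W\<close>, irreducibility of \<open>W' / W\<close> forces it to be everything.\<close>

lemma covers_preimage:
  assumes cov: "covers W W'" and W: "smod W" and W': "smod W'"
    and T: "Vector_Spaces.linear uscale uscale T" and TW: "\<And>w. w \<in> W \<Longrightarrow> T w \<in> W"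
    and inv: "\<And>w y. w \<in> W' \<Longrightarrow> T w \<in> W \<Longrightarrow> y = x \<or> y \<in> A \<Longrightarrow> T (act y w) \<in> W"
    and u: "u \<in> W'" "u \<notin> W" "T u \<in> W" and w: "w \<in> W'"
  shows "T w \<in> W"
proof -
  interpret T: Vector_Spaces.linear uscale uscale T by (fact T)
  let ?K = "{w \<in> W'. T w \<in> W}"
  note sub = submodule_subspace[OF W] submodule_subspace[OF W']
  have "U.subspace ?K"
    by (rule U.subspaceI)
      (use sub in \<open>auto simp: T.zero T.add T.scale U.subspace_0 U.subspace_add U.subspace_scale\<close>)
  then have "smod ?K"
    using inv submodule_act[OF W'] by (auto simp: submodule_iff)
  moreover have "W \<subseteq> ?K" "?K \<subseteq> W'" using cov TW by (auto simp: covers_def)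
  ultimately have "?K = W'" using cov u unfolding covers_def by blast
  with w show ?thesis by blast
qed

lemma E_nonzero_nilpotent:
  assumes "a \<in> E \<delta>" "\<delta> \<noteq> 0"
  obtains n where "\<And>u. (act a ^^ n) u = 0"
proof -
  have "bracket x (scale (inverse \<delta>) a) = a"
    using assms by (simp add: bracket_scale ad_eigenspace_def)
  then have "a \<in> derived_algebra scale bracket"
    unfolding derived_algebra_def by (metis (mono_tags, lifting) mem_Collect_eq span_base)
  then have "\<exists>n. \<forall>u. (act a ^^ n) u = 0" using admissible unfolding admissible_def by blast
  with that show ?thesis by blast
qed

text \<open>Being nilpotent, \<open>a\<close> carries some vector of \<open>W'\<close> outside \<open>W\<close> into \<open>W\<close>; since \<open>[x, a]\<close> is a multiple
  of \<open>a\<close>, the vectors with this property together with \<open>W\<close> form a submodule.\<close>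

lemma covers_E_nonzero:
  assumes cov: "covers W W'" and W: "smod W" and W': "smod W'"
    and a: "a \<in> E \<delta>" "\<delta> \<noteq> 0" and w: "w \<in> W'"
  shows "act a w \<in> W"
proof -
  obtain e where e: "e \<in> W'" "e \<notin> W" using cov by (auto simp: covers_def)
  obtain n where n: "\<And>u. (act a ^^ n) u = 0" using E_nonzero_nilpotent[OF a] by blast
  then have "(act a ^^ n) e \<in> W" using U.subspace_0[OF submodule_subspace[OF W]] by simp
  then have "\<exists>k. (act a ^^ Suc k) e \<in> W \<and> (act a ^^ k) e \<notin> W"
  proof (induction n)
    case 0
    with e(2) show ?case by simp
  next
    case (Suc n)
    then show ?case by blast
  qed
  then obtain k where k: "(act a ^^ Suc k) e \<in> W" "(act a ^^ k) e \<notin> W" by blast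
  have "(act a ^^ k) e \<in> W'"
    by (induction k) (use e(1) submodule_act[OF W'] in auto)
  show ?thesis
  proof (rule covers_preimage[OF cov W W' act_linear_right _ _ _ k(2)])
    fix u y assume u: "u \<in> W'" "act a u \<in> W" "y = x \<or> y \<in> A"
    note sub = submodule_subspace[OF W]
    from u(3) show "act a (act y u) \<in> W"
    proof
      assume "y = x"
      then have "act a (act y u) = act x (act a u) - uscale \<delta> (act a u)"
        using act_x_E[OF a(1)] by simp
      then show ?thesis
        using u(2) sub submodule_act[OF W] by (simp add: U.subspace_diff U.subspace_scale)
    next
      assume "y \<in> A"
      then show ?thesis
        using u(2) act_A_commute[OF E_in_A[OF a(1)] \<open>y \<in> A\<close>, of u] submodule_act[OF W] by simp
    qed
  qed (use k w submodule_act[OF W] \<open>(act a ^^ k) e \<in> W'\<close> in auto)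
qed

text \<open>An element that commutes with the action modulo \<open>W\<close> has an eigenvector on the irreducible module
  \<open>W' / W\<close>, and its eigenspace there is a submodule.\<close>

lemma covers_scalar:
  assumes fd: "finite_dimensional_vector_space uscale Basis"
    and cov: "covers W W'" and W: "smod W" and W': "smod W'"
    and comm: "\<And>w z. w \<in> W' \<Longrightarrow> z = x \<or> z \<in> A \<Longrightarrow> act (bracket y z) w \<in> W"
  obtains c where "\<And>w. w \<in> W' \<Longrightarrow> act y w - uscale c w \<in> W"
proof -
  note sub = submodule_subspace[OF W] submodule_subspace[OF W']
  obtain e where e: "e \<in> W'" "e \<notin> W" using cov by (auto simp: covers_def)
  obtain c u where u: "u \<in> W'" "u \<notin> W" "act y u - uscale c u \<in> W"
    using eigenvector_mod[OF fd act_linear_right[of y] sub submodule_act[OF W'] e] .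
  have lin: "Vector_Spaces.linear uscale uscale (\<lambda>w. act y w - uscale c w)"
    by unfold_locales
      (simp_all add: act_add act_uscale U.scale_right_distrib U.scale_right_diff_distrib
        U.scale_left_commute)
  have "act y w - uscale c w \<in> W" if "w \<in> W'" for w
  proof (rule covers_preimage[OF cov W W' lin _ _ u that])
    fix w z assume w: "w \<in> W'" "act y w - uscale c w \<in> W" "z = x \<or> z \<in> A"
    have "act y (act z w) - uscale c (act z w)
        = act z (act y w - uscale c w) + act (bracket y z) w"
      by (simp add: act_bracket act_diff act_uscale algebra_simps)
    with w comm sub submodule_act[OF W] show "act y (act z w) - uscale c (act z w) \<in> W"
      by (simp add: U.subspace_add)
  qed (use sub submodule_act[OF W] in \<open>auto simp: U.subspace_diff U.subspace_scale\<close>)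
  with that show ?thesis by blast
qed

lemma bracket_E_covers:
  assumes cov: "covers W W'" and W: "smod W" and W': "smod W'"
    and a: "a \<in> A" and w: "w \<in> W'"
  shows "act (bracket x a) w \<in> W"
proof (rule A_induct[of "\<lambda>a. act (bracket x a) w \<in> W", OF _ _ a])
  note sub = submodule_subspace[OF W]
  show "subspace {a. act (bracket x a) w \<in> W}"
    using sub by (auto simp: subspace_def bracket_add bracket_zero bracket_scale act_zero_left
        act_add_left act_scale_left U.subspace_0 U.subspace_add U.subspace_scale)
  fix \<delta> a assume a: "a \<in> E \<delta>"
  then have "act (bracket x a) w = uscale \<delta> (act a w)"
    by (simp add: ad_eigenspace_def act_scale_left)
  moreover have "act a w \<in> W" if "\<delta> \<noteq> 0"
    using covers_E_nonzero[OF cov W W' a that w] .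
  ultimately show "act (bracket x a) w \<in> W"
    using sub by (cases "\<delta> = 0") (auto simp: U.subspace_0 U.subspace_scale)
qed

lemma covers_scalar_x:
  assumes fd: "finite_dimensional_vector_space uscale Basis"
    and cov: "covers W W'" and W: "smod W" and W': "smod W'"
  obtains c where "\<And>w. w \<in> W' \<Longrightarrow> act x w - uscale c w \<in> W"
proof (rule covers_scalar[OF fd cov W W', of x])
  fix w z assume "w \<in> W'" "z = x \<or> z \<in> A"
  then show "act (bracket x z) w \<in> W"
    using bracket_E_covers[OF cov W W'] submodule_subspace[OF W]
    by (auto simp: bracket_self act_zero_left U.subspace_0)
qed (rule that)

lemma covers_scalar_E:
  assumes fd: "finite_dimensional_vector_space uscale Basis"
    and cov: "covers W W'" and W: "smod W" and W': "smod W'" and a: "a \<in> E \<delta>"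
  obtains c where "\<And>w. w \<in> W' \<Longrightarrow> act a w - uscale c w \<in> W"
proof (cases "\<delta> = 0")
  case True
  have "bracket a x = - bracket x a"
    by (rule bracket_antisym)
  then have "bracket a x = 0" using a True by (simp add: ad_eigenspace_def)
  then have "act (bracket a z) w \<in> W" if "z = x \<or> z \<in> A" for w z
    using that a U.subspace_0[OF submodule_subspace[OF W]]
    by (auto simp: bracket_A_A E_in_A act_zero_left)
  then obtain c where "\<And>w. w \<in> W' \<Longrightarrow> act a w - uscale c w \<in> W"
    using covers_scalar[OF fd cov W W', of a] by metis
  with that show ?thesis by blast
next
  case False
  then show ?thesis using covers_E_nonzero[OF cov W W' a] that[of 0] by auto
qed

text \<open>Since \<open>x\<close> and the eigenvectors of \<open>ad x\<close> act on \<open>W' / W\<close> by scalars, every line in \<open>W' / W\<close> is a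
  submodule.\<close>

lemma covers_line:
  assumes fd: "finite_dimensional_vector_space uscale Basis"
    and cov: "covers W W'" and W: "smod W" and W': "smod W'"
    and e: "e \<in> W'" "e \<notin> W" and u: "u \<in> W'"
  obtains c where "u - uscale c e \<in> W"
proof -
  note sub = submodule_subspace[OF W] submodule_subspace[OF W']
  let ?N = "{u. \<exists>c. u - uscale c e \<in> W}"
  have N: "U.subspace ?N"
    by (rule U.subspace_plus_line[OF sub(1)])
  have scal: "act y w \<in> ?N" if w: "w \<in> ?N" and c: "\<And>w. w \<in> W' \<Longrightarrow> act y w - uscale c w \<in> W" for y w c
  proof -
    from w obtain d where d: "w - uscale d e \<in> W" by auto
    have "act y w - uscale (c * d) e = act y (w - uscale d e) + uscale d (act y e - uscale c e)"
      by (simp add: act_diff act_uscale U.scale_right_diff_distrib mult.commute)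
    also have "\<dots> \<in> W"
      using d c[OF e(1)] sub submodule_act[OF W] by (simp add: U.subspace_add U.subspace_scale)
    finally show ?thesis by blast
  qed
  have "smod ?N"
  proof (rule submoduleI[OF N])
    fix w assume w: "w \<in> ?N"
    obtain c where c: "\<And>w. w \<in> W' \<Longrightarrow> act x w - uscale c w \<in> W"
      using covers_scalar_x[OF fd cov W W'] by blast
    show "act x w \<in> ?N" by (rule scal[OF w c])
    fix a \<delta> assume a: "a \<in> E \<delta>"
    obtain c where c: "\<And>w. w \<in> W' \<Longrightarrow> act a w - uscale c w \<in> W"
      using covers_scalar_E[OF fd cov W W' a] by blast
    show "act a w \<in> ?N" by (rule scal[OF w c])
  qed
  moreover have "W \<subseteq> ?N" by (auto intro: exI[of _ 0])
  moreover have "?N \<subseteq> W'"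
  proof
    fix w assume "w \<in> ?N"
    then obtain d where "w - uscale d e \<in> W'" using cov unfolding covers_def by blast
    then have "(w - uscale d e) + uscale d e \<in> W'"
      using e(1) sub(2) by (blast intro: U.subspace_add U.subspace_scale)
    then show "w \<in> W'" by simp
  qed
  moreover have "e \<in> ?N" by (auto intro!: exI[of _ 1] U.subspace_0[OF sub(1)])
  ultimately have "?N = W'" using cov e(2) unfolding covers_def by blast
  with u that show ?thesis by blast
qed

end

section \<open>The flag of a uniserial module\<close>

locale uniserial_module = line_extension scale bracket uscale act x A
  for scale :: "'f::alg_closed_field \<Rightarrow> 'g::ab_group_add \<Rightarrow> 'g"
    and bracket :: "'g \<Rightarrow> 'g \<Rightarrow> 'g"
    and uscale :: "'f \<Rightarrow> 'u::ab_group_add \<Rightarrow> 'u"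
    and act :: "'g \<Rightarrow> 'u \<Rightarrow> 'u" and x :: 'g and A :: "'g set" +
  fixes m :: nat
  assumes fd: "\<exists>Basis. finite_dimensional_vector_space uscale Basis"
    and uniserial: "uniserial uscale act"
    and composition_length: "has_composition_length uscale act m"
begin

definition series :: "'u set list" where
  "series = (THE Ws. composition_series uscale act Ws)"

definition W :: "nat \<Rightarrow> 'u set" where
  "W k = series ! k"

definition e :: "nat \<Rightarrow> 'u" where
  "e k = (SOME u. u \<in> W (Suc k) \<and> u \<notin> W k)"

text \<open>The weight of \<open>x\<close> on the factor \<open>W (Suc k) / W k\<close>.\<close>

definition wt :: "nat \<Rightarrow> 'f" where
  "wt k = (SOME c. \<forall>u \<in> W (Suc k). act x u - uscale c u \<in> W k)"

lemma series: "composition_series uscale act series"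
  and length_series: "length series = Suc m"
proof -
  obtain Ws where Ws: "composition_series uscale act Ws" "length Ws = Suc m"
    using composition_length unfolding has_composition_length_def by blast
  have "series = Ws"
    unfolding series_def using uniserial Ws(1) unfolding uniserial_def by (rule the1_equality)
  with Ws show "composition_series uscale act series" "length series = Suc m" by simp_all
qed

lemma W_smod: "k \<le> m \<Longrightarrow> smod (W k)"
  using series length_series by (auto simp: W_def composition_series_iff)

lemmas W_subspace = W_smod[THEN submodule_subspace]
lemmas W_act = submodule_act[OF W_smod]

lemma W_0: "W 0 = {0}"
  using series by (auto simp: W_def composition_series_iff hd_conv_nth)

lemma W_m: "W m = UNIV"
  using series length_series by (auto simp: W_def composition_series_iff last_conv_nth)

lemma W_covers: "k < m \<Longrightarrow> covers (W k) (W (Suc k))"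
  using series length_series by (auto simp: W_def composition_series_iff successively_conv_nth)

lemma W_mono: "i \<le> j \<Longrightarrow> j \<le> m \<Longrightarrow> W i \<subseteq> W j"
proof (induction j rule: dec_induct)
  case (step j)
  then show ?case using W_covers[of j] by (auto simp: covers_def)
qed simp

lemma submodule_is_W:
  assumes "smod N"
  obtains k where "k \<le> m" "N = W k"
proof -
  obtain Basis where "finite_dimensional_vector_space uscale Basis" using fd by blast
  then have "N \<in> set series"
    using uniserial_submodule_in_series[OF _ uniserial series assms] by blast
  then obtain k where "k < Suc m" "N = W k"
    using length_series by (auto simp: in_set_conv_nth W_def)
  with that[of k] show ?thesis by simp
qed

lemma e_in_W: "k < m \<Longrightarrow> e k \<in> W (Suc k)" and e_notin_W: "k < m \<Longrightarrow> e k \<notin> W k"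
proof -
  assume "k < m"
  then have "W k \<subset> W (Suc k)" using W_covers unfolding covers_def by blast
  then have "\<exists>u. u \<in> W (Suc k) \<and> u \<notin> W k" by blast
  from someI_ex[OF this] show "e k \<in> W (Suc k)" "e k \<notin> W k" by (auto simp: e_def)
qed

lemma W_line:
  assumes "k < m" "b \<in> W (Suc k)" "b \<notin> W k" "u \<in> W (Suc k)"
  obtains c where "u - uscale c b \<in> W k"
proof -
  obtain Basis where "finite_dimensional_vector_space uscale Basis" using fd by blast
  then show ?thesis
    by (rule covers_line[OF _ W_covers W_smod W_smod _ _ _ that]) (use assms in auto)
qed

lemma x_weight:
  assumes "k < m" "u \<in> W (Suc k)"
  shows "act x u - uscale (wt k) u \<in> W k"
proof -
  obtain Basis where "finite_dimensional_vector_space uscale Basis" using fd by blast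
  then obtain c where "\<And>u. u \<in> W (Suc k) \<Longrightarrow> act x u - uscale c u \<in> W k"
    by (rule covers_scalar_x[OF _ W_covers W_smod W_smod, of Basis k]) (use assms(1) in auto)
  then have "\<exists>c. \<forall>u \<in> W (Suc k). act x u - uscale c u \<in> W k" by blast
  from someI_ex[OF this] assms(2) show ?thesis by (auto simp: wt_def)
qed

lemma E_weight:
  assumes "k < m" "a \<in> E \<delta>"
  obtains c where "\<And>u. u \<in> W (Suc k) \<Longrightarrow> act a u - uscale c u \<in> W k"
proof -
  obtain Basis where "finite_dimensional_vector_space uscale Basis" using fd by blast
  then show ?thesis
    by (rule covers_scalar_E[OF _ W_covers W_smod W_smod assms(2) that, of Basis k]) (use assms(1) in auto)
qed

lemma E_nonzero_lowers:
  assumes "a \<in> E \<delta>" "\<delta> \<noteq> 0" "k < m" "u \<in> W (Suc k)"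
  shows "act a u \<in> W k"
  using covers_E_nonzero[OF W_covers W_smod W_smod assms(1,2,4)] assms(3) by simp

lemma scale_notin_W:
  assumes "k \<le> m" "u \<notin> W k" "uscale c u \<in> W k"
  shows "c = 0"
proof (rule ccontr)
  assume "c \<noteq> 0"
  then show False using U.subspace_scale[OF W_subspace[OF assms(1)] assms(3), of "inverse c"] assms(2)
    by simp
qed

text \<open>Because each factor is a line, vectors chosen one from each step span the flag term by term.\<close>

lemma flag_basis:
  assumes b: "\<And>k. k < m \<Longrightarrow> b k \<in> W (Suc k)" "\<And>k. k < m \<Longrightarrow> b k \<notin> W k"
  shows "distinct (map b [0..<m])" "U.independent (b ` {..<m})" "U.span (b ` {..<m}) = UNIV"
proof -
  have *: "inj_on b {..<k} \<and> U.independent (b ` {..<k}) \<and> U.span (b ` {..<k}) = W k" if "k \<le> m" for k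
    using that
  proof (induction k)
    case 0
    then show ?case by (simp add: W_0 U.independent_empty)
  next
    case (Suc k)
    then have k: "k < m" and IH: "inj_on b {..<k}" "U.independent (b ` {..<k})" "U.span (b ` {..<k}) = W k"
      by auto
    have new: "b k \<notin> U.span (b ` {..<k})" using b(2)[OF k] IH(3) by simp
    then have "b k \<notin> b ` {..<k}" by (rule contra_subsetD[OF U.span_superset])
    then have inj: "inj_on b {..<Suc k}" using IH(1) by (simp add: lessThan_Suc)
    have ind: "U.independent (b ` {..<Suc k})"
      using IH(2) new by (simp add: lessThan_Suc U.independent_insertI)
    have "U.span (b ` {..<Suc k}) \<subseteq> W (Suc k)"
    proof (rule U.span_minimal[OF _ W_subspace])
      show "b ` {..<Suc k} \<subseteq> W (Suc k)" 
      proof (rule image_subsetI)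
        fix i assume "i \<in> {..<Suc k}"
        then show "b i \<in> W (Suc k)" using b(1)[of i] W_mono[of "Suc i" "Suc k"] k by auto
      qed
    qed (use k in simp)
    moreover have "u \<in> U.span (b ` {..<Suc k})" if u: "u \<in> W (Suc k)" for u
    proof -
      obtain c where c: "u - uscale c (b k) \<in> W k" using W_line[OF k b(1)[OF k] b(2)[OF k] u] .
      then have "u - uscale c (b k) \<in> U.span (b ` {..<Suc k})"
        using IH(3) U.span_mono[of "b ` {..<k}" "b ` {..<Suc k}"] by (auto simp: lessThan_Suc)
      moreover have "uscale c (b k) \<in> U.span (b ` {..<Suc k})"
        by (intro U.span_scale U.span_base) simp
      ultimately have "(u - uscale c (b k)) + uscale c (b k) \<in> U.span (b ` {..<Suc k})"
        by (rule U.span_add)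
      then show ?thesis by simp
    qed
    ultimately show ?case using inj ind by blast
  qed
  from *[of m] W_m show "U.independent (b ` {..<m})" "U.span (b ` {..<m}) = UNIV"
    "distinct (map b [0..<m])"
    by (auto simp: distinct_map atLeast0LessThan)
qed

lemma dim_UNIV: "U.dim UNIV = m"
proof -
  note basis = flag_basis[of e, OF e_in_W e_notin_W]
  have "card (e ` {..<m}) = m"
    using basis(1) by (simp add: distinct_map card_image atLeast0LessThan)
  then show ?thesis
    using U.dim_eq_card[of "e ` {..<m}" UNIV] basis(2,3) by simp
qed

section \<open>Weight operators\<close>

text \<open>Eigenvectors of \<open>ad x\<close> in \<open>A\<close> act by operators that commute with \<open>A\<close> and with \<open>x\<close> up to a
  multiple of the operator itself, and so does a central element shifted by a scalar. Such an operator
  maps submodules to submodules, hence moves the terms of the flag to terms of the flag.\<close>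

definition weight_operator :: "'f \<Rightarrow> ('u \<Rightarrow> 'u) \<Rightarrow> bool" where
  "weight_operator \<delta> T \<longleftrightarrow> Vector_Spaces.linear uscale uscale T
     \<and> (\<forall>a\<in>A. \<forall>u. act a (T u) = T (act a u))
     \<and> (\<forall>u. act x (T u) = T (act x u) + uscale \<delta> (T u))"

lemma weight_operator_E: "a \<in> E \<delta> \<Longrightarrow> weight_operator \<delta> (act a)"
  by (simp add: weight_operator_def act_linear_right act_x_E act_A_commute E_in_A)

lemma weight_operator_shift:
  assumes "a \<in> E 0"
  shows "weight_operator 0 (\<lambda>u. act a u - uscale c u)"
proof -
  have "Vector_Spaces.linear uscale uscale (\<lambda>u. act a u - uscale c u)"
    by unfold_locales
      (simp_all add: act_add act_uscale U.scale_right_distrib U.scale_right_diff_distrib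
        U.scale_left_commute)
  then show ?thesis
    using act_x_E[OF assms] act_A_commute[OF E_in_A[OF assms]]
    by (simp add: weight_operator_def act_diff act_uscale)
qed

context
  fixes \<delta> T
  assumes T: "weight_operator \<delta> T"
begin

interpretation T: Vector_Spaces.linear uscale uscale T
  using T by (simp add: weight_operator_def)

lemma weight_operator_x: "act x (T u) = T (act x u) + uscale \<delta> (T u)"
  using T by (simp add: weight_operator_def)

lemma weight_operator_image:
  assumes N: "smod N"
  shows "smod (T ` N)"
  unfolding submodule_iff
proof (intro conjI ballI)
  note sub = submodule_subspace[OF N]
  show "U.subspace (T ` N)" using sub by (rule T.subspace_image)
  then show "act x u \<in> T ` N" if "u \<in> T ` N" for u
    using that submodule_act[OF N]
    by (auto simp: weight_operator_x intro!: U.subspace_add U.subspace_scale)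
  show "act a u \<in> T ` N" if "a \<in> A" "u \<in> T ` N" for a u
    using that submodule_act[OF N] T by (auto simp: weight_operator_def)
qed

lemma weight_operator_kernel: "smod {u. T u = 0}"
  unfolding submodule_iff
proof (intro conjI ballI)
  show "U.subspace {u. T u = 0}" by (rule T.subspace_kernel)
  show "act x u \<in> {u. T u = 0}" if "u \<in> {u. T u = 0}" for u
    using that weight_operator_x[of u] by (simp add: act_zero)
  show "act a u \<in> {u. T u = 0}" if "a \<in> A" "u \<in> {u. T u = 0}" for a u
  proof -
    have "T (act a u) = act a (T u)" using T that(1) by (simp add: weight_operator_def)
    with that(2) show ?thesis by (simp add: act_zero)
  qed
qed

text \<open>The image of \<open>W (Suc k)\<close> is a term of the flag and exceeds the image of \<open>W k\<close> by at most one
  dimension.\<close>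

lemma image_step:
  assumes k: "k < m" and j: "j < m" and TW: "T ` W k \<subseteq> W j"
  shows "T ` W (Suc k) \<subseteq> W (Suc j)"
proof (rule ccontr)
  assume not: "\<not> ?thesis"
  have "smod (T ` W (Suc k))" using k by (intro weight_operator_image W_smod) simp
  then obtain i where i: "i \<le> m" "T ` W (Suc k) = W i" by (rule submodule_is_W)
  have "\<not> i \<le> Suc j" using not i W_mono[of i "Suc j"] j by auto
  then have "W (Suc j) \<subseteq> T ` W (Suc k)" using i W_mono[of "Suc j" i] by auto
  then obtain u where u: "u \<in> W (Suc k)" "e j = T u" using e_in_W[OF j] by auto
  obtain c where c: "u - uscale c (e k) \<in> W k"
    using W_line[OF k e_in_W[OF k] e_notin_W[OF k] u(1)] .
  then have ej: "e j - uscale c (T (e k)) \<in> W j"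
    using TW by (auto simp: u(2) T.diff[symmetric] T.scale[symmetric])
  note sub = W_subspace[of j] W_subspace[of "Suc j"]
  have "c \<noteq> 0" using ej e_notin_W[OF j] by auto
  have "e j - uscale c (T (e k)) \<in> W (Suc j)" using ej W_mono[of j "Suc j"] j by auto
  then have "e j - (e j - uscale c (T (e k))) \<in> W (Suc j)"
    by (rule U.subspace_diff[OF W_subspace e_in_W[OF j], rotated]) (use j in simp)
  then have "uscale c (T (e k)) \<in> W (Suc j)" by simp
  then have Te: "T (e k) \<in> W (Suc j)" using scale_notin_W[of "Suc j"] j \<open>c \<noteq> 0\<close> by auto
  have "T w \<in> W (Suc j)" if w: "w \<in> W (Suc k)" for w
  proof -
    obtain d where d: "w - uscale d (e k) \<in> W k"
      using W_line[OF k e_in_W[OF k] e_notin_W[OF k] w] .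
    have "T w = T (w - uscale d (e k)) + uscale d (T (e k))" by (simp add: T.diff T.scale)
    also have "\<dots> \<in> W (Suc j)"
      using d TW W_mono[of j "Suc j"] j sub(2) Te by (intro U.subspace_add U.subspace_scale) auto
    finally show ?thesis .
  qed
  with not show False by auto
qed

lemma lowers_if_kills_socle:
  assumes "\<And>u. u \<in> W 1 \<Longrightarrow> T u = 0" and "k < m"
  shows "T ` W (Suc k) \<subseteq> W k"
  using \<open>k < m\<close>
proof (induction k)
  case 0
  then show ?case using assms(1) by (auto simp: W_0)
next
  case (Suc k)
  then show ?case by (intro image_step) auto
qed

lemma lowers_twice_if_kills_W2:
  assumes "\<And>u. u \<in> W 2 \<Longrightarrow> T u = 0" and "Suc k < m"
  shows "T ` W (Suc (Suc k)) \<subseteq> W k"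
  using \<open>Suc k < m\<close>
proof (induction k)
  case 0
  then show ?case using assms(1) by (auto simp: W_0 numeral_2_eq_2)
next
  case (Suc k)
  then show ?case by (intro image_step) auto
qed

lemma weight_shift:
  assumes socle: "\<And>u. u \<in> W 1 \<Longrightarrow> T u = 0" and k: "Suc k < m"
    and u: "u \<in> W (Suc (Suc k))" "T u \<notin> W k"
  shows "wt k = wt (Suc k) + \<delta>"
proof -
  have km: "k < m" "k \<le> m" using k by auto
  note sub = W_subspace[OF km(2)]
  have "T u \<in> W (Suc k)" using lowers_if_kills_socle[OF socle k] u(1) by auto
  then have 1: "act x (T u) - uscale (wt k) (T u) \<in> W k" by (rule x_weight[OF km(1)])
  have "act x u - uscale (wt (Suc k)) u \<in> W (Suc k)" by (rule x_weight[OF k u(1)])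
  then have 2: "T (act x u - uscale (wt (Suc k)) u) \<in> W k"
    using lowers_if_kills_socle[OF socle km(1)] by auto
  have "uscale (wt k - wt (Suc k) - \<delta>) (T u)
      = T (act x u - uscale (wt (Suc k)) u) - (act x (T u) - uscale (wt k) (T u))"
    by (simp add: weight_operator_x T.diff T.scale U.scale_left_diff_distrib)
  also have "\<dots> \<in> W k" using sub 1 2 by (simp add: U.subspace_diff)
  finally have "wt k - wt (Suc k) - \<delta> = 0" by (rule scale_notin_W[OF km(2) u(2)])
  then show ?thesis by (simp add: algebra_simps)
qed

text \<open>If the image of \<open>e (Suc (Suc k))\<close> fell into \<open>W (Suc k)\<close>, it would coincide with the image of a vector
  of \<open>W (Suc (Suc k))\<close>. The difference would lie in the kernel, which is a term of the flag that
  does not contain \<open>e 1\<close> and hence is at most the socle.\<close>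

lemma lowers_exactly:
  assumes socle: "\<And>u. u \<in> W 1 \<Longrightarrow> T u = 0" and e1: "T (e 1) \<noteq> 0" and k: "Suc k < m"
  shows "T (e (Suc k)) \<notin> W k"
  using k
proof (induction k)
  case 0
  then show ?case using e1 by (simp add: W_0)
next
  case (Suc k)
  then have km: "Suc k < m" "Suc (Suc k) < m" "k < m" by auto
  have IH: "T (e (Suc k)) \<notin> W k" using Suc by simp
  show ?case
  proof
    assume in_W: "T (e (Suc (Suc k))) \<in> W (Suc k)"
    have "smod (T ` W (Suc (Suc k)))" using km by (intro weight_operator_image W_smod) simp
    then obtain i where i: "i \<le> m" "T ` W (Suc (Suc k)) = W i" by (rule submodule_is_W)
    have "T (e (Suc k)) \<in> W i" using i(2) e_in_W[OF km(1)] by auto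
    then have "\<not> i \<le> k" using IH W_mono[of i k] km by auto
    then have "W (Suc k) \<subseteq> T ` W (Suc (Suc k))" using i W_mono[of "Suc k" i] by auto
    then obtain w where w: "w \<in> W (Suc (Suc k))" "T (e (Suc (Suc k))) = T w"
      using in_W by auto
    have "smod {u. T u = 0}" by (rule weight_operator_kernel)
    then obtain d where d: "d \<le> m" "{u. T u = 0} = W d" by (rule submodule_is_W)
    have "d \<le> 1"
    proof (rule ccontr)
      assume "\<not> d \<le> 1"
      then have "W 2 \<subseteq> W d" using W_mono[of 2 d] d by simp
      then show False using e_in_W[of 1] km d(2) e1 by (auto simp: numeral_2_eq_2)
    qed
    then have "W d \<subseteq> W (Suc (Suc k))" using W_mono[of d "Suc (Suc k)"] km by simp
    moreover have "e (Suc (Suc k)) - w \<in> W d"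
      using w(2) d(2)[symmetric] by (simp add: T.diff)
    ultimately have "(e (Suc (Suc k)) - w) + w \<in> W (Suc (Suc k))"
      using w(1) W_subspace[of "Suc (Suc k)"] km by (intro U.subspace_add) auto
    then show False using e_notin_W[OF km(2)] by simp
  qed
qed

text \<open>A non-zero weight operator sends the first flag vector that it does not kill to the socle, so its
  weight is a difference of two weights of the module.\<close>

lemma weight_is_difference:
  assumes nz: "T u \<noteq> 0"
  obtains j where "j < m" "\<delta> = wt 0 - wt j"
proof -
  define k where "k = (LEAST k. \<exists>u \<in> W k. T u \<noteq> 0)"
  have ex: "\<exists>u \<in> W m. T u \<noteq> 0" using nz W_m by auto
  have k: "\<exists>u \<in> W k. T u \<noteq> 0" unfolding k_def using ex by (rule LeastI)
  have "k \<le> m" unfolding k_def using ex by (rule Least_le)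
  have "k \<noteq> 0" using k by (metis T.zero W_0 singletonD)
  then obtain j where j: "k = Suc j" using not0_implies_Suc by blast
  then have jm: "j < m" using \<open>k \<le> m\<close> by simp
  have kill: "T w = 0" if "w \<in> W j" for w
    using not_less_Least[of j "\<lambda>k. \<exists>u \<in> W k. T u \<noteq> 0"] that j k_def by auto
  from k j obtain w where w: "w \<in> W (Suc j)" "T w \<noteq> 0" by auto
  have "w \<notin> W j" using kill w(2) by auto
  have "smod (T ` W (Suc j))" using jm by (intro weight_operator_image W_smod) simp
  then obtain i where i: "i \<le> m" "T ` W (Suc j) = W i" by (rule submodule_is_W)
  have "i \<noteq> 0" using i(2) w W_0 by auto
  then have "W 1 \<subseteq> T ` W (Suc j)" using i W_mono[of 1 i] by simp
  moreover have m: "0 < m" using jm by simp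
  ultimately obtain u where u: "u \<in> W (Suc j)" "e 0 = T u" using e_in_W[OF m] by auto
  obtain c where "u - uscale c w \<in> W j" using W_line[OF jm w(1) \<open>w \<notin> W j\<close> u(1)] .
  then have "T (u - uscale c w) = 0" by (rule kill)
  then have e0: "e 0 = uscale c (T w)" using u(2) by (simp add: T.diff T.scale)
  then have "c \<noteq> 0" using e_notin_W[OF m] W_0 by auto
  have "act x (e 0) - uscale (wt 0) (e 0) = 0"
    using x_weight[OF m, of "e 0"] e_in_W[OF m] W_0 by auto
  then have "uscale c (act x (T w) - uscale (wt 0) (T w)) = 0"
    by (simp add: e0 act_uscale U.scale_right_diff_distrib U.scale_left_commute)
  then have 1: "act x (T w) = uscale (wt 0) (T w)" using \<open>c \<noteq> 0\<close> by simp
  have "T (act x w - uscale (wt j) w) = 0" by (rule kill[OF x_weight[OF jm w(1)]])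
  then have "T (act x w) = uscale (wt j) (T w)" by (simp add: T.diff T.scale)
  with 1 weight_operator_x[of w] have "uscale (wt 0) (T w) = uscale (wt j) (T w) + uscale \<delta> (T w)"
    by simp
  then have "uscale (wt 0 - wt j - \<delta>) (T w) = 0"
    by (simp add: U.scale_left_diff_distrib U.scale_left_distrib diff_diff_eq)
  with w(2) have "wt 0 - wt j - \<delta> = 0" by simp
  then show ?thesis using that jm by simp
qed

end

section \<open>An eigenvector that acts as a full Jordan block\<close>

lemma E_kills_socle:
  assumes "0 < m" "a \<in> E \<delta>"
  obtains c where "\<And>u. u \<in> W 1 \<Longrightarrow> act a u - uscale c u = 0"
proof (rule E_weight[OF assms])
  fix c assume "\<And>u. u \<in> W (Suc 0) \<Longrightarrow> act a u - uscale c u \<in> W 0"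
  then show thesis by (intro that[of c]) (simp add: W_0)
qed

lemma constant_weights_trivial:
  assumes const: "\<And>k. Suc k < m \<Longrightarrow> wt k = wt (Suc k)" and a: "a \<in> E \<delta>" "\<delta> \<noteq> 0"
  shows "act a u = 0"
proof (rule ccontr)
  assume "act a u \<noteq> 0"
  then obtain j where j: "j < m" "\<delta> = wt 0 - wt j"
    using weight_is_difference[OF weight_operator_E[OF a(1)]] by blast
  have "wt 0 = wt j" using j(1)
    by (induction j) (use const in auto)
  with j a(2) show False by simp
qed

text \<open>If every eigenvector of \<open>ad x\<close> in \<open>A\<close> acts by a scalar on \<open>W (Suc (Suc k)) / W k\<close>, then \<open>x\<close> alone has to
  glue the two composition factors together. With distinct weights \<open>x\<close> would be diagonalizable there,
  and its second eigenvector would span with \<open>W k\<close> a submodule that is not in the flag.\<close>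

lemma weights_agree:
  assumes k: "Suc k < m"
    and scal: "\<And>a \<delta>. a \<in> E \<delta> \<Longrightarrow> \<exists>c. \<forall>u \<in> W (Suc (Suc k)). act a u - uscale c u \<in> W k"
  shows "wt k = wt (Suc k)"
proof (rule ccontr)
  assume ne: "wt k \<noteq> wt (Suc k)"
  have km: "k < m" "k \<le> m" "Suc k \<le> m" "Suc (Suc k) \<le> m" using k by auto
  note sub = W_subspace[OF km(2)]
  have "act x (e (Suc k)) - uscale (wt (Suc k)) (e (Suc k)) \<in> W (Suc k)"
    by (rule x_weight[OF k e_in_W[OF k]])
  then obtain s where s: "act x (e (Suc k)) - uscale (wt (Suc k)) (e (Suc k)) - uscale s (e k) \<in> W k"
    using W_line[OF km(1) e_in_W[OF km(1)] e_notin_W[OF km(1)]] by blast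
  \<comment> \<open>an eigenvector of \<open>x\<close> modulo \<open>W k\<close> outside \<open>W (Suc k)\<close>\<close>
  define r where "r = s / (wt (Suc k) - wt k)"
  define b where "b = e (Suc k) + uscale r (e k)"
  have ek: "e k \<in> W (Suc (Suc k))" using e_in_W[OF km(1)] W_mono[of "Suc k" "Suc (Suc k)"] k by auto
  have b_in: "b \<in> W (Suc (Suc k))" unfolding b_def
    by (intro U.subspace_add U.subspace_scale W_subspace ek e_in_W[OF k] km)
  have b_notin: "b \<notin> W (Suc k)"
  proof
    assume "b \<in> W (Suc k)"
    then have "b - uscale r (e k) \<in> W (Suc k)"
      by (intro U.subspace_diff U.subspace_scale W_subspace e_in_W km)
    then show False using e_notin_W[OF k] by (simp add: b_def)
  qed
  have xek: "act x (e k) - uscale (wt k) (e k) \<in> W k" by (rule x_weight[OF km(1) e_in_W[OF km(1)]])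
  have "s = r * (wt (Suc k) - wt k)" using ne by (simp add: r_def)
  then have sk: "uscale s (e k) = uscale (r * wt (Suc k)) (e k) - uscale (r * wt k) (e k)"
    by (simp add: right_diff_distrib U.scale_left_diff_distrib)
  have "act x b - uscale (wt (Suc k)) b
     = (act x (e (Suc k)) - uscale (wt (Suc k)) (e (Suc k)) - uscale s (e k))
       + uscale r (act x (e k) - uscale (wt k) (e k))"
    unfolding sk
    by (simp add: b_def act_add act_uscale U.scale_right_distrib U.scale_right_diff_distrib mult.commute)
  also have "\<dots> \<in> W k" using s xek by (intro U.subspace_add U.subspace_scale sub)
  finally have xb: "act x b - uscale (wt (Suc k)) b \<in> W k" .
  let ?N = "{u. \<exists>c. u - uscale c b \<in> W k}"
  have N: "U.subspace ?N" by (rule U.subspace_plus_line[OF sub])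
  have stable: "act y w \<in> ?N" if w: "w \<in> ?N" and c: "act y b - uscale c b \<in> W k" for y w c
  proof -
    from w obtain d where d: "w - uscale d b \<in> W k" by auto
    have "act y w - uscale (d * c) b = act y (w - uscale d b) + uscale d (act y b - uscale c b)"
      by (simp add: act_diff act_uscale U.scale_right_diff_distrib)
    also have "\<dots> \<in> W k"
      using d c W_act[OF km(2)] by (intro U.subspace_add U.subspace_scale sub) auto
    finally show ?thesis by blast
  qed
  have "smod ?N"
  proof (rule submoduleI[OF N])
    fix w assume w: "w \<in> ?N"
    show "act x w \<in> ?N" by (rule stable[OF w xb])
    fix a \<delta> assume "a \<in> E \<delta>"
    then obtain c where "act a b - uscale c b \<in> W k" using scal b_in by blast
    then show "act a w \<in> ?N" by (rule stable[OF w])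
  qed
  then obtain i where i: "i \<le> m" "?N = W i" by (rule submodule_is_W)
  have "b \<in> ?N" by (auto intro!: exI[of _ 1] U.subspace_0[OF sub])
  then have "\<not> i \<le> Suc k" using b_notin i W_mono[of i "Suc k"] km by auto
  then have "W (Suc k) \<subseteq> ?N" using i W_mono[of "Suc k" i] by auto
  then obtain c where c: "e k - uscale c b \<in> W k" using e_in_W[OF km(1)] by auto
  have "W k \<subseteq> W (Suc k)" using W_mono[of k "Suc k"] k by auto
  with c have "e k - (e k - uscale c b) \<in> W (Suc k)"
    by (intro U.subspace_diff[OF W_subspace[OF km(3)] e_in_W[OF km(1)] subsetD[of "W k"]])
  then have "uscale c b \<in> W (Suc k)" by simp
  then have "c = 0" by (rule scale_notin_W[OF km(3) b_notin])
  with c e_notin_W[OF km(1)] show False by simp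
qed

text \<open>Suppose that all eigenvectors of \<open>ad x\<close> of non-zero eigenvalue kill \<open>W 2\<close>. If a central element,
  shifted by a scalar, kills the socle but not \<open>W 2\<close>, then it carries each composition factor to the
  next lower one and commutes with \<open>x\<close>, so all weights of \<open>x\<close> agree. If there is no such element,
  the weights agree by the preceding lemma. Equal weights leave no room for the non-zero eigenvalue
  of an element that acts non-trivially.\<close>

lemma non_central_jordan_vector_exists:
  assumes m: "1 < m" and nontriv: "a \<in> E \<delta>" "\<delta> \<noteq> 0" "act a u \<noteq> 0"
  obtains \<delta> v where "\<delta> \<noteq> 0" "v \<in> E \<delta>" "act v (e 1) \<noteq> 0"
proof -
  have "\<exists>\<delta> v. \<delta> \<noteq> 0 \<and> v \<in> E \<delta> \<and> act v (e 1) \<noteq> 0"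
  proof (rule ccontr)
    assume no: "\<not> ?thesis"
    have kills: "T u = 0" if T: "weight_operator \<delta> T" and socle: "\<And>u. u \<in> W 1 \<Longrightarrow> T u = 0"
      and e1: "T (e 1) = 0" and u: "u \<in> W 2" for T \<delta> u
    proof -
      interpret T: Vector_Spaces.linear uscale uscale T
        using T by (simp add: weight_operator_def)
      obtain c where "u - uscale c (e 1) \<in> W 1"
        using W_line[OF m e_in_W[OF m] e_notin_W[OF m]] u by (metis Suc_1)
      then have "T (u - uscale c (e 1)) = 0" by (rule socle)
      then show ?thesis using e1 by (simp add: T.diff T.scale)
    qed
    have "\<exists>k. Suc k < m \<and> wt k \<noteq> wt (Suc k)"
      using constant_weights_trivial[OF _ nontriv(1,2)] nontriv(3) by blast
    then obtain k where k: "Suc k < m" "wt k \<noteq> wt (Suc k)" by blast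
    have "\<exists>c. \<forall>u \<in> W (Suc (Suc k)). act b u - uscale c u \<in> W k" if b: "b \<in> E \<epsilon>" for b \<epsilon>
    proof (cases "\<epsilon> = 0")
      case False
      have socle: "act b u = 0" if "u \<in> W 1" for u
        using E_nonzero_lowers[OF b False, of 0 u] m that W_0 by auto
      have "act b u = 0" if "u \<in> W 2" for u
        using kills[OF weight_operator_E[OF b] socle _ that] no b False by blast
      then have "act b ` W (Suc (Suc k)) \<subseteq> W k"
        using lowers_twice_if_kills_W2[OF weight_operator_E[OF b] _ k(1)] by blast
      then show ?thesis by (auto intro!: exI[of _ 0])
    next
      case True
      obtain c where c: "\<And>u. u \<in> W 1 \<Longrightarrow> act b u - uscale c u = 0"
        using E_kills_socle[OF _ b] m by (metis gr_implies_not0 neq0_conv)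
      note T = weight_operator_shift[OF b[unfolded True], of c]
      have "act b (e 1) - uscale c (e 1) = 0"
      proof (rule ccontr)
        assume nz: "act b (e 1) - uscale c (e 1) \<noteq> 0"
        have "act b (e (Suc k)) - uscale c (e (Suc k)) \<notin> W k"
          using lowers_exactly[OF T c nz k(1)] by blast
        then have "wt k = wt (Suc k) + 0"
          using weight_shift[OF T c k(1) e_in_W[OF k(1)]] by blast
        with k(2) show False by simp
      qed
      then have "(\<lambda>u. act b u - uscale c u) ` W (Suc (Suc k)) \<subseteq> W k"
        using lowers_twice_if_kills_W2[OF T _ k(1)] kills[OF T c] by blast
      then show ?thesis by auto
    qed
    then have "wt k = wt (Suc k)" by (intro weights_agree[OF k(1)])
    with k(2) show False ..
  qed
  with that show ?thesis by blast
qed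

lemma E_nonzero_powers_lower:
  assumes v: "v \<in> E \<delta>" "\<delta> \<noteq> 0" and u: "u \<in> W k" and k: "k \<le> m"
  shows "(act v ^^ n) u \<in> W (k - n)"
proof (induction n)
  case (Suc n)
  show ?case
  proof (cases "n < k")
    case True
    then have "Suc (k - Suc n) = k - n" by simp
    then show ?thesis using E_nonzero_lowers[OF v, of "k - Suc n" "(act v ^^ n) u"] Suc True k by simp
  next
    case False
    then show ?thesis using Suc by (simp add: W_0 act_zero)
  qed
qed (use u in simp)

text \<open>Such a vector lowers each step of the flag by exactly one, so its power of exponent \<open>m - 1\<close> takes
  the top of the flag to the socle.\<close>

lemma jordan_vector_power_nonzero:
  assumes v: "v \<in> E \<delta>" "\<delta> \<noteq> 0" and e1: "act v (e 1) \<noteq> 0" and m: "0 < m"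
  obtains u where "(act v ^^ (m - 1)) u \<noteq> 0"
proof -
  note T = weight_operator_E[OF v(1)]
  have socle: "act v u = 0" if "u \<in> W 1" for u
    using E_nonzero_lowers[OF v, of 0 u] m that W_0 by auto
  have step: "act v u \<notin> W k" if k: "Suc k < m" and u: "u \<in> W (Suc (Suc k))" "u \<notin> W (Suc k)" for k u
  proof
    assume vu: "act v u \<in> W k"
    obtain c where c: "e (Suc k) - uscale c u \<in> W (Suc k)"
      using W_line[OF k u e_in_W[OF k]] .
    then have "act v (e (Suc k) - uscale c u) \<in> W k"
      using E_nonzero_lowers[OF v, of k] k by simp
    then have "act v (e (Suc k) - uscale c u) + uscale c (act v u) \<in> W k"
      using vu k by (intro U.subspace_add U.subspace_scale W_subspace) auto
    then have "act v (e (Suc k)) \<in> W k" by (simp add: act_diff act_uscale)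
    with lowers_exactly[OF T socle e1 k] show False by blast
  qed
  have "(act v ^^ n) (e (m - 1)) \<notin> W (m - Suc n)" if "n < m" for n
    using that
  proof (induction n)
    case 0
    then show ?case using e_notin_W[of "m - 1"] by simp
  next
    case (Suc n)
    define k where "k = m - Suc (Suc n)"
    have k: "Suc k < m" "m - Suc n = Suc k" "m - n = Suc (Suc k)" using Suc.prems by (auto simp: k_def)
    have "(act v ^^ n) (e (m - 1)) \<in> W (Suc (Suc k))"
      using E_nonzero_powers_lower[OF v, of "e (m - 1)" m n] e_in_W[of "m - 1"] W_m k by simp
    then show ?case using step[OF k(1)] Suc k by (simp add: k_def[symmetric])
  qed
  from this[of "m - 1"] m have "(act v ^^ (m - 1)) (e (m - 1)) \<noteq> 0" by (simp add: W_0)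
  with that show ?thesis by blast
qed

end

section \<open>Upper triangular Toeplitz matrices\<close>

text \<open>This is the power series with coefficients \<open>c\<close> evaluated at the nilpotent Jordan block, which turns
  membership in \<open>FJ\<close> into a condition on the exponents that occur.\<close>

definition toeplitz :: "nat \<Rightarrow> (nat \<Rightarrow> 'f::field) \<Rightarrow> 'f mat" where
  "toeplitz m c = mat m m (\<lambda>(r, s). if r \<le> s then c (s - r) else 0)"

lemma toeplitz_carrier: "toeplitz m c \<in> carrier_mat m m"
  by (simp add: toeplitz_def)

lemma toeplitz_add: "toeplitz m (\<lambda>n. c n + d n) = toeplitz m c + toeplitz m d"
  by (rule eq_matI) (simp_all add: toeplitz_def)

lemma toeplitz_smult: "toeplitz m (\<lambda>n. a * c n) = a \<cdot>\<^sub>m toeplitz m c"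
  by (rule eq_matI) (simp_all add: toeplitz_def)

lemma toeplitz_cong: "(\<And>n. n < m \<Longrightarrow> c n = d n) \<Longrightarrow> toeplitz m c = toeplitz m d"
  by (rule eq_matI) (simp_all add: toeplitz_def)

lemma J_mat_eq_toeplitz: "J_mat m = toeplitz m (\<lambda>n. if n = 1 then 1 else 0)"
  by (rule eq_matI) (auto simp: toeplitz_def)

lemma J_mat_power: "J_mat m ^\<^sub>m k = toeplitz m (\<lambda>n. if n = k then 1 else 0)"
  by (rule eq_matI) (auto simp: toeplitz_def jordan_block_pow power_0_left binomial_eq_0)

lemma toeplitz_times_J_mat_power:
  "toeplitz m c * J_mat m ^\<^sub>m i = toeplitz m (\<lambda>n. if i \<le> n then c (n - i) else 0)" (is "?L = ?R")
proof (rule eq_matI)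
  fix r s assume "r < dim_row ?R" "s < dim_col ?R"
  then have rs: "r < m" "s < m" by (simp_all add: toeplitz_def)
  have "?L $$ (r, s) = (\<Sum>k<m. (if r \<le> k then c (k - r) else 0)
      * (if k \<le> s \<and> s - k = i then 1 else 0))"
    using rs unfolding J_mat_power
    by (auto simp: toeplitz_def times_mat_def scalar_prod_def lessThan_atLeast0 intro!: sum.cong)
  also have "\<dots> = (\<Sum>k<m. if k = s - i \<and> i \<le> s then if r \<le> k then c (k - r) else 0 else 0)"
    by (rule sum.cong) auto
  also have "\<dots> = (if i \<le> s \<and> r \<le> s - i then c (s - i - r) else 0)"
    using rs by (cases "i \<le> s") auto
  also have "\<dots> = ?R $$ (r, s)"
    using rs by (auto simp: toeplitz_def add.commute)
  finally show "?L $$ (r, s) = ?R $$ (r, s)" .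
qed (simp_all add: toeplitz_def)

lemma J_mat_power_power: "((J_mat m :: 'f::field mat) ^\<^sub>m p) ^\<^sub>m k = toeplitz m (\<lambda>n. if n = p * k then 1 else 0)"
proof (induction k)
  case 0
  then show ?case by (auto simp: toeplitz_def intro!: eq_matI)
next
  case (Suc k)
  have "((J_mat m :: 'f mat) ^\<^sub>m p) ^\<^sub>m Suc k = toeplitz m (\<lambda>n. if n = p * k then 1 else 0) * J_mat m ^\<^sub>m p"
    using Suc by simp
  also have "\<dots> = toeplitz m (\<lambda>n. if n = p * Suc k then 1 else 0)"
    unfolding toeplitz_times_J_mat_power by (rule toeplitz_cong) auto
  finally show ?case .
qed

lemma poly_mat_J_mat_power:
  assumes p: "0 < p"
  shows "poly_mat h (J_mat m ^\<^sub>m p) = toeplitz m (\<lambda>n. if p dvd n then coeff h (n div p) else 0)"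
    (is "?L = ?R")
proof (rule eq_matI)
  fix r s assume "r < dim_row ?R" "s < dim_col ?R"
  then have rs: "r < m" "s < m" by (simp_all add: toeplitz_def)
  have "?L $$ (r, s) = (\<Sum>k\<le>degree h. coeff h k * (if r \<le> s \<and> s - r = p * k then 1 else 0))"
    unfolding poly_mat_def J_mat_power_power using rs
    by (auto simp: toeplitz_def intro!: sum.cong)
  also have "\<dots> = (\<Sum>k\<le>degree h. if k = (s - r) div p \<and> r \<le> s \<and> p dvd (s - r)
      then coeff h k else 0)"
    using p by (intro sum.cong) auto
  also have "\<dots> = (if r \<le> s \<and> p dvd (s - r) then coeff h ((s - r) div p) else 0)"
    by (cases "r \<le> s \<and> p dvd (s - r)") (auto simp: coeff_eq_0)
  also have "\<dots> = ?R $$ (r, s)" using rs by (auto simp: toeplitz_def)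
  finally show "?L $$ (r, s) = ?R $$ (r, s)" .
qed (simp_all add: toeplitz_def poly_mat_def)

lemma toeplitz_in_FJ:
  assumes p: "0 < p" and c: "\<And>n. n < m \<Longrightarrow> c n \<noteq> 0 \<Longrightarrow> i \<le> n \<and> p dvd (n - i)"
  shows "toeplitz m c \<in> FJ p m i"
proof -
  define h where "h = (\<Sum>q<m. monom (c (i + p * q)) q)"
  have h: "coeff h q = (if q < m then c (i + p * q) else 0)" for q
    by (simp add: h_def coeff_sum)
  have "poly_mat h (J_mat m ^\<^sub>m p) * J_mat m ^\<^sub>m i = toeplitz m c"
    unfolding poly_mat_J_mat_power[OF p] toeplitz_times_J_mat_power
  proof (rule toeplitz_cong)
    fix n assume n: "n < m"
    show "(if i \<le> n then if p dvd n - i then coeff h ((n - i) div p) else 0 else 0) = c n"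
    proof (cases "i \<le> n \<and> p dvd n - i")
      case True
      then obtain q where q: "n = i + p * q" by (metis dvdE le_add_diff_inverse)
      then have "q \<le> n" using p by (simp add: trans_le_add2)
      then show ?thesis using q n p by (simp add: h)
    qed (use c[OF n] in auto)
  qed
  then show ?thesis unfolding FJ_def by (metis (mono_tags, lifting) mem_Collect_eq)
qed

context uniserial_module
begin

section \<open>Cyclic vectors for a Jordan element\<close>

context
  fixes v
  assumes v: "v \<in> E 1" and m_pos: "0 < m"
begin

abbreviation V :: "nat \<Rightarrow> 'u \<Rightarrow> 'u" where
  "V n \<equiv> act v ^^ n"

lemma
  V_add: "V n (u + w) = V n u + V n w" and
  V_diff: "V n (u - w) = V n u - V n w" and
  V_scale: "V n (uscale c u) = uscale c (V n u)"
  by (induction n) (simp_all add: act_add act_diff act_uscale)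

lemma V_sum: "V n (sum f I) = (\<Sum>i\<in>I. V n (f i))"
  by (induction n) (simp_all add: act_sum)

lemma V_V: "V n (V k u) = V (n + k) u"
  by (simp add: funpow_add)

lemma V_act_A: "a \<in> A \<Longrightarrow> act a (V n u) = V n (act a u)"
  by (induction n) (simp_all add: act_A_commute[OF _ E_in_A[OF v]])

lemma x_V: "act x (V n u) = V n (act x u) + uscale (of_nat n) (V n u)"
proof (induction n)
  case (Suc n)
  have "act x (act v (V n u)) = act v (act x (V n u)) + act v (V n u)"
    using act_x_E[OF v] by simp
  then show ?case
    by (simp add: Suc act_add act_uscale U.scale_left_distrib)
qed simp

lemma V_lowers: "u \<in> W k \<Longrightarrow> k \<le> m \<Longrightarrow> V n u \<in> W (k - n)"
  using E_nonzero_powers_lower[OF v, of u k n] by simp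

lemma V_large: "m \<le> n \<Longrightarrow> V n u = 0"
  using V_lowers[of u m n] by (simp add: W_0 W_m)

definition cyclic :: "'u \<Rightarrow> bool" where
  "cyclic w \<longleftrightarrow> V (m - 1) w \<noteq> 0"

lemma cyclic_in_W: "V n w \<in> W (m - n)"
  using V_lowers[of w m n] by (simp add: W_m)

lemma cyclic_notin_W:
  assumes w: "cyclic w" and n: "n < m"
  shows "V n w \<notin> W (m - Suc n)"
proof
  assume "V n w \<in> W (m - Suc n)"
  then have "V (m - Suc n) (V n w) \<in> W 0"
    using V_lowers[of "V n w" "m - Suc n" "m - Suc n"] by simp
  with w n show False by (simp add: cyclic_def V_V W_0)
qed

text \<open>The element \<open>v\<close> carries each composition factor to the next lower one and raises the weight of \<open>x\<close>
  by its eigenvalue \<open>1\<close>.\<close>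

lemma weights_consecutive:
  assumes w: "cyclic w" and k: "k < m"
  shows "wt 0 - wt k = of_nat k"
  using k
proof (induction k)
  case (Suc k)
  have socle: "act v u = 0" if "u \<in> W 1" for u
    using E_nonzero_lowers[OF v, of 0 u] m_pos that W_0 by auto
  define n where "n = m - Suc (Suc k)"
  have n: "n < m" "m - n = Suc (Suc k)" "Suc n < m" "m - Suc (Suc n) = k"
    using Suc.prems by (auto simp: n_def)
  have "V n w \<in> W (Suc (Suc k))" "act v (V n w) \<notin> W k"
    using cyclic_in_W[of n w] cyclic_notin_W[OF w n(3)] n by simp_all
  then have "wt k = wt (Suc k) + 1"
    using weight_shift[OF weight_operator_E[OF v] socle Suc.prems] by blast
  with Suc show ?case by (simp add: algebra_simps)
qed simp

text \<open>Rescaling the cyclic vector \<open>w\<close> by a unit of \<open>F[v]\<close> removes from the expansion of \<open>x w\<close> in powers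
  of \<open>v\<close> each term whose exponent \<open>n\<close> is invertible in \<open>F\<close>, one exponent at a time: replacing \<open>w\<close> by
  \<open>w + c v\<^sup>n w\<close> adds \<open>n c v\<^sup>n w\<close> to the remainder, up to higher powers of \<open>v\<close>.\<close>

lemma normalized_cyclic_vector_mod:
  assumes p: "\<And>n. \<not> p dvd n \<Longrightarrow> (of_nat n :: 'f) \<noteq> 0" and w0: "cyclic w0"
  shows "n \<le> m \<Longrightarrow> \<exists>w f. cyclic w \<and> (\<forall>k. \<not> p dvd k \<longrightarrow> f k = 0)
    \<and> act x w - (\<Sum>k<n. uscale (f k) (V k w)) \<in> W (m - n)"
proof (induction n)
  case 0
  show ?case using w0 by (auto simp: W_m intro!: exI[of _ w0] exI[of _ "\<lambda>_. 0"])
next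
  case (Suc n)
  then obtain w f where w: "cyclic w" and f: "\<forall>k. \<not> p dvd k \<longrightarrow> f k = 0"
    and r: "act x w - (\<Sum>k<n. uscale (f k) (V k w)) \<in> W (m - n)" by auto
  define r where "r = act x w - (\<Sum>k<n. uscale (f k) (V k w))"
  have n: "n < m" "Suc (m - Suc n) = m - n" using Suc by auto
  have Vn: "V n w \<in> W (Suc (m - Suc n))" "r \<in> W (Suc (m - Suc n))"
    using cyclic_in_W[of n w] r n(2) by (simp_all add: r_def)
  obtain d where d: "r - uscale d (V n w) \<in> W (m - Suc n)"
    by (rule W_line[OF _ Vn(1) cyclic_notin_W[OF w n(1)] Vn(2)]) (use n(1) in simp)
  show ?case
  proof (cases "p dvd n")
    case True
    define f' where "f' = f(n := d)"
    have "(\<Sum>k<n. uscale (f' k) (V k w)) = (\<Sum>k<n. uscale (f k) (V k w))"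
      by (rule sum.cong) (simp_all add: f'_def)
    then have "act x w - (\<Sum>k<Suc n. uscale (f' k) (V k w)) = r - uscale d (V n w)"
      by (simp add: r_def f'_def algebra_simps)
    moreover have "\<forall>k. \<not> p dvd k \<longrightarrow> f' k = 0" using f True by (simp add: f'_def)
    ultimately show ?thesis using w d by (intro exI[of _ w] exI[of _ f']) simp
  next
    case False
    then have n0: "(of_nat n :: 'f) \<noteq> 0" "0 < n" using p[of n] by (auto intro: Nat.gr0I)
    define c where "c = - d / of_nat n"
    define w' where "w' = w + uscale c (V n w)"
    have cn: "c * of_nat n = - d" using n0 by (simp add: c_def)
    have "V (m - 1) w' = V (m - 1) w"
      using V_large[of "m - 1 + n" w] n0(2) by (simp add: w'_def V_add V_scale V_V)
    then have w': "cyclic w'" using w by (simp add: cyclic_def)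
    have "(\<Sum>k<Suc n. uscale (f k) (V k w')) = (\<Sum>k<n. uscale (f k) (V k w'))"
      using f False by simp
    also have "\<dots> = (\<Sum>k<n. uscale (f k) (V k w)) + uscale c (V n (\<Sum>k<n. uscale (f k) (V k w)))"
    proof -
      have "uscale (f k) (V k w') = uscale (f k) (V k w) + uscale c (V n (uscale (f k) (V k w)))" for k
        by (simp add: w'_def V_add V_scale V_V U.scale_right_distrib add.commute[of k n]
            U.scale_left_commute[of c])
      then show ?thesis by (simp add: sum.distrib V_sum U.scale_sum_right)
    qed
    finally have sum: "(\<Sum>k<Suc n. uscale (f k) (V k w'))
      = (\<Sum>k<n. uscale (f k) (V k w)) + uscale c (V n (\<Sum>k<n. uscale (f k) (V k w)))" .
    have "act x w' = act x w + uscale c (V n (act x w)) - uscale d (V n w)"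
      by (simp add: w'_def act_add act_uscale x_V U.scale_right_distrib cn)
    then have "act x w' - (\<Sum>k<Suc n. uscale (f k) (V k w')) = (r - uscale d (V n w)) + uscale c (V n r)"
      unfolding sum r_def by (simp add: V_diff U.scale_right_diff_distrib)
    also have "\<dots> \<in> W (m - Suc n)"
    proof (intro U.subspace_add W_subspace U.subspace_scale d)
      have "V n r \<in> W (m - n - n)" by (rule V_lowers) (use r r_def in simp_all)
      moreover have "m - n - n \<le> m - Suc n" using n0(2) by linarith
      ultimately show "V n r \<in> W (m - Suc n)" using W_mono[of "m - n - n" "m - Suc n"] by auto
    qed simp_all
    finally show ?thesis using w' f by (intro exI[of _ w'] exI[of _ f]) simp
  qed
qed

lemma normalized_cyclic_vector:
  assumes p: "\<And>n. \<not> p dvd n \<Longrightarrow> (of_nat n :: 'f) \<noteq> 0" and w0: "cyclic w0"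
  obtains w f where "cyclic w" "\<And>k. \<not> p dvd k \<Longrightarrow> f k = 0"
    "act x w = (\<Sum>k<m. uscale (f k) (V k w))"
proof -
  have "\<exists>w f. cyclic w \<and> (\<forall>k. \<not> p dvd k \<longrightarrow> f k = 0)
    \<and> act x w - (\<Sum>k<m. uscale (f k) (V k w)) \<in> W (m - m)"
    by (rule normalized_cyclic_vector_mod[OF _ w0 order.refl]) (rule p)
  then obtain w f where "cyclic w"
    "\<forall>k. \<not> p dvd k \<longrightarrow> f k = 0" "act x w - (\<Sum>k<m. uscale (f k) (V k w)) = 0"
    by (auto simp: W_0)
  then show ?thesis using that[of w f] by simp
qed

section \<open>Coordinates relative to a cyclic vector\<close>

context
  fixes w
  assumes w: "cyclic w"
begin

text \<open>The powers of \<open>v\<close> are listed downwards, from the socle to the top of the flag, so that \<open>v\<close> becomes an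
  upper triangular Jordan block.\<close>

abbreviation b :: "nat \<Rightarrow> 'u" where
  "b k \<equiv> V (m - Suc k) w"

lemma b_in_W: "k < m \<Longrightarrow> b k \<in> W (Suc k)" and b_notin_W: "k < m \<Longrightarrow> b k \<notin> W k"
  using cyclic_in_W[of "m - Suc k" w] cyclic_notin_W[OF w, of "m - Suc k"] by simp_all

lemmas b_basis = flag_basis[of b, OF b_in_W b_notin_W]

lemma V_inj: "inj_on (\<lambda>n. V n w) {..<m}"
proof (rule inj_onI)
  fix i j assume ij: "i \<in> {..<m}" "j \<in> {..<m}" "V i w = V j w"
  have "inj_on b {..<m}" using b_basis(1) by (simp add: distinct_map atLeast0LessThan)
  moreover have "b (m - Suc i) = b (m - Suc j)" using ij by simp
  ultimately have "m - Suc i = m - Suc j" by (rule inj_onD) (use ij in auto)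
  with ij show "i = j" by auto
qed

lemma V_image: "(\<lambda>n. V n w) ` {..<m} = b ` {..<m}"
proof -
  have "(\<lambda>k. m - Suc k) ` {..<m} = {..<m}"
  proof safe
    fix k assume "k < m"
    then show "k \<in> (\<lambda>k. m - Suc k) ` {..<m}" by (intro image_eqI[of _ _ "m - Suc k"]) auto
  qed auto
  then show ?thesis by (metis (no_types, lifting) image_cong image_image)
qed

definition coord :: "'u \<Rightarrow> nat \<Rightarrow> 'f" where
  "coord u n = U.representation ((\<lambda>n. V n w) ` {..<m}) u (V n w)"

lemma coord_expand: "u = (\<Sum>n<m. uscale (coord u n) (V n w))"
proof -
  have "u = (\<Sum>b\<in>(\<lambda>n. V n w) ` {..<m}.
      uscale (U.representation ((\<lambda>n. V n w) ` {..<m}) u b) b)"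
    using b_basis by (subst U.sum_representation_eq) (simp_all add: V_image)
  then show ?thesis by (simp add: sum.reindex[OF V_inj] coord_def)
qed

lemma coord_add: "coord (u + u') n = coord u n + coord u' n"
  and coord_scale: "coord (uscale c u) n = c * coord u n"
  using b_basis by (simp_all add: coord_def V_image U.representation_add U.representation_scale)

lemma coord_unique:
  assumes "n < m"
  shows "coord (\<Sum>k<m. uscale (c k) (V k w)) n = c n"
proof -
  have V: "coord (V k w) n = (if k = n then 1 else 0)" if "k < m" for k
  proof -
    have "coord (V k w) n = (if V n w = V k w then 1 else 0)"
      unfolding coord_def using b_basis(2) that by (subst U.representation_basis) (auto simp flip: V_image)
    then show ?thesis using inj_on_eq_iff[OF V_inj, of n k] that assms by auto
  qed
  have "coord (\<Sum>k\<in>I. uscale (c k) (V k w)) n = (\<Sum>k\<in>I. c k * coord (V k w) n)" if "finite I" for I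
    using that
  proof (induction I rule: finite_induct)
    case empty
    have "coord (uscale 0 0) n = 0 * coord 0 n" by (rule coord_scale)
    then show ?case by simp
  qed (simp add: coord_add coord_scale)
  then have "coord (\<Sum>k<m. uscale (c k) (V k w)) n = (\<Sum>k<m. c k * coord (V k w) n)" by simp
  also have "\<dots> = (\<Sum>k<m. if k = n then c k else 0)"
    by (rule sum.cong) (simp_all add: V)
  finally show ?thesis using assms by simp
qed

text \<open>Everything in \<open>A\<close> acts as a polynomial in \<open>v\<close>, because it commutes with \<open>v\<close> and \<open>w\<close> is cyclic.\<close>

lemma A_acts_by_polynomial:
  assumes a: "a \<in> A"
  shows "act a u = (\<Sum>n<m. uscale (coord (act a w) n) (V n u))"
proof -
  have "act a u = (\<Sum>k<m. uscale (coord u k) (V k (act a w)))"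
  proof -
    have "act a (\<Sum>k<m. uscale (coord u k) (V k w)) = (\<Sum>k<m. uscale (coord u k) (V k (act a w)))"
      by (simp add: act_sum act_uscale V_act_A[OF a])
    then show ?thesis by (simp only: coord_expand[of u, symmetric])
  qed
  also have "\<dots> = (\<Sum>k<m. uscale (coord u k) (V k (\<Sum>n<m. uscale (coord (act a w) n) (V n w))))"
    by (simp only: coord_expand[of "act a w", symmetric])
  also have "\<dots> = (\<Sum>k<m. \<Sum>n<m. uscale (coord u k * coord (act a w) n) (V (k + n) w))"
    by (simp only: V_sum V_scale V_V U.scale_sum_right U.scale_scale)
  also have "\<dots> = (\<Sum>n<m. \<Sum>k<m. uscale (coord u k * coord (act a w) n) (V (k + n) w))"
    by (rule sum.swap)
  also have "\<dots> = (\<Sum>n<m. uscale (coord (act a w) n) (V n (\<Sum>k<m. uscale (coord u k) (V k w))))"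
    by (simp only: V_sum V_scale V_V U.scale_sum_right U.scale_scale add.commute mult.commute)
  also have "\<dots> = (\<Sum>n<m. uscale (coord (act a w) n) (V n u))"
    by (simp only: coord_expand[of u, symmetric])
  finally show ?thesis .
qed

text \<open>The commutator with \<open>x\<close> multiplies the coefficient of \<open>v\<^sup>n\<close> by \<open>n\<close>, so an eigenvector of
  eigenvalue \<open>\<delta>\<close> involves only exponents \<open>n\<close> equal to \<open>\<delta>\<close> in \<open>F\<close>.\<close>

lemma E_exponents:
  assumes a: "a \<in> E \<delta>" and n: "n < m" and c: "coord (act a w) n \<noteq> 0"
  shows "of_nat n = \<delta>"
proof -
  let ?c = "coord (act a w)"
  note poly = A_acts_by_polynomial[OF E_in_A[OF a]]
  have "(\<Sum>n<m. uscale (?c n) (V n (act x w))) + uscale \<delta> (\<Sum>n<m. uscale (?c n) (V n w))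
      = act a (act x w) + uscale \<delta> (act a w)"
    by (simp only: poly[symmetric])
  also have "\<dots> = act x (act a w)"
    using act_x_E[OF a] by simp
  also have "\<dots> = act x (\<Sum>n<m. uscale (?c n) (V n w))"
    by (simp only: poly[symmetric])
  also have "\<dots> = (\<Sum>n<m. uscale (?c n) (V n (act x w)))
      + (\<Sum>n<m. uscale (?c n * of_nat n) (V n w))"
    by (simp add: act_sum act_uscale x_V U.scale_right_distrib sum.distrib)
  finally have "(\<Sum>n<m. uscale (\<delta> * ?c n) (V n w)) = (\<Sum>n<m. uscale (?c n * of_nat n) (V n w))"
    by (simp add: U.scale_sum_right)
  then have "coord (\<Sum>n<m. uscale (\<delta> * ?c n) (V n w)) n
      = coord (\<Sum>n<m. uscale (?c n * of_nat n) (V n w)) n" by (rule arg_cong)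
  then have "\<delta> * ?c n = of_nat n * ?c n"
    unfolding coord_unique[OF n] by (simp only: mult.commute)
  with c show ?thesis by simp
qed

section \<open>Representing matrices\<close>

abbreviation es :: "'u list" where
  "es \<equiv> map b [0..<m]"

lemma es_basis: "ordered_basis uscale es" "length es = m"
proof -
  have "set es = b ` {..<m}" by (simp add: atLeast0LessThan)
  then show "ordered_basis uscale es" using b_basis by (simp add: ordered_basis_def)
qed simp

lemma toeplitz_column:
  assumes j: "j < m"
  shows "(\<Sum>r<m. uscale (toeplitz m c $$ (r, j)) (b r)) = (\<Sum>n<m. uscale (c n) (V n (b j)))"
proof -
  have "(\<Sum>r<m. uscale (toeplitz m c $$ (r, j)) (b r)) = (\<Sum>r\<in>{..j}. uscale (c (j - r)) (b r))"
    using j by (intro sum.mono_neutral_cong_right) (auto simp: toeplitz_def)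
  also have "\<dots> = (\<Sum>n\<in>{..j}. uscale (c n) (b (j - n)))"
    by (rule sum.reindex_bij_witness[of _ "\<lambda>n. j - n" "\<lambda>r. j - r"]) auto
  also have "\<dots> = (\<Sum>n<m. uscale (c n) (V n (b j)))"
  proof (rule sum.mono_neutral_cong_left)
    show "\<forall>n\<in>{..<m} - {..j}. uscale (c n) (V n (b j)) = 0"
      using j by (auto simp: V_V V_large)
    show "uscale (c n) (b (j - n)) = uscale (c n) (V n (b j))" if "n \<in> {..j}" for n
    proof -
      have "m - Suc (j - n) = n + (m - Suc j)" using j that by auto
      then show ?thesis by (simp only: V_V)
    qed
  qed (use j in auto)
  finally show ?thesis .
qed

lemma A_represented:
  assumes a: "a \<in> A"
  shows "represented_by uscale es (act a) (toeplitz m (coord (act a w)))"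
  unfolding represented_by_def
proof (intro conjI allI impI)
  show "toeplitz m (coord (act a w)) \<in> carrier_mat (length es) (length es)"
    by (simp add: toeplitz_carrier)
  fix j assume "j < length es"
  then have j: "j < m" by simp
  have "act a (b j) = (\<Sum>n<m. uscale (coord (act a w) n) (V n (b j)))"
    by (rule A_acts_by_polynomial[OF a])
  also have "\<dots> = (\<Sum>r<m. uscale (toeplitz m (coord (act a w)) $$ (r, j)) (b r))"
    by (rule toeplitz_column[OF j, symmetric])
  also have "\<dots> = (\<Sum>r<length es. uscale (toeplitz m (coord (act a w)) $$ (r, j)) (es ! r))"
    by (rule sum.cong) simp_all
  finally show "act a (es ! j) = \<dots>" using j by simp
qed

text \<open>On \<open>b j = v\<^sup>k w\<close> with \<open>k = m - 1 - j\<close> the commutator with \<open>v\<^sup>k\<close> contributes \<open>k\<close> to the diagonal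
  entry, which is therefore \<open>f 0 + (m - 1) - j\<close>.\<close>

lemma x_represented:
  assumes f: "act x w = (\<Sum>k<m. uscale (f k) (V k w))"
  shows "represented_by uscale es (act x)
    (D_mat m (f 0 + of_nat (m - 1)) + toeplitz m (\<lambda>k. if k = 0 then 0 else f k))"
    (is "represented_by _ _ _ ?Y")
  unfolding represented_by_def
proof (intro conjI allI impI)
  show "?Y \<in> carrier_mat (length es) (length es)"
    by (simp add: D_mat_def mat_diag_def toeplitz_carrier)
  fix j assume "j < length es"
  then have j: "j < m" by simp
  have entry: "?Y $$ (r, j) = toeplitz m f $$ (r, j) + (if r = j then of_nat (m - Suc j) else 0)"
    if "r < m" for r
    using that j by (auto simp: D_mat_def mat_diag_def toeplitz_def of_nat_diff)
  have "act x (b j) = V (m - Suc j) (act x w) + uscale (of_nat (m - Suc j)) (b j)"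
    by (rule x_V)
  also have "V (m - Suc j) (act x w) = (\<Sum>n<m. uscale (f n) (V n (b j)))"
    by (simp add: f V_sum V_scale V_V add.commute)
  also have "\<dots> = (\<Sum>r<m. uscale (toeplitz m f $$ (r, j)) (b r))"
    by (rule toeplitz_column[OF j, symmetric])
  also have "uscale (of_nat (m - Suc j)) (b j)
      = (\<Sum>r<m. uscale (if r = j then of_nat (m - Suc j) else 0) (b r))"
    using j by (simp add: if_distrib[of "\<lambda>c. uscale c _"] cong: if_cong)
  also have "(\<Sum>r<m. uscale (toeplitz m f $$ (r, j)) (b r))
      + (\<Sum>r<m. uscale (if r = j then of_nat (m - Suc j) else 0) (b r))
      = (\<Sum>r<m. uscale (?Y $$ (r, j)) (b r))"
    unfolding sum.distrib[symmetric]
    by (rule sum.cong) (simp_all only: entry U.scale_left_distrib lessThan_iff)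
  also have "\<dots> = (\<Sum>r<length es. uscale (?Y $$ (r, j)) (es ! r))"
    by (rule sum.cong) simp_all
  finally show "act x (es ! j) = (\<Sum>r<length es. uscale (?Y $$ (r, j)) (es ! r))"
    using j by simp
qed

end

end

end

section \<open>The matrix form and multiplicities\<close>

lemma of_nat_eq_of_nat_iff:
  assumes "CHAR('f::field) = p" and "(of_nat n :: 'f) = of_nat i" and "i < p"
  shows "i \<le> n \<and> p dvd (n - i)"
proof -
  have "[n = i] (mod p)" using assms(1,2) of_nat_eq_iff_cong_CHAR[of n i] by metis
  then have "n mod p = i" using assms(3) by (simp add: cong_def)
  then have "n = p * (n div p) + i" by (metis mult_div_mod_eq)
  then show ?thesis by (metis add_diff_cancel_right' dvd_triv_left le_add2)
qed

lemma card_residue_class_le: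
  assumes p: "0 < p" and i: "i < m"
  shows "card {n. n < m \<and> i \<le> n \<and> p dvd (n - i)} \<le> (m - Suc i) div p + 1"
proof -
  have "{n. n < m \<and> i \<le> n \<and> p dvd (n - i)} \<subseteq> (\<lambda>q. i + p * q) ` {..(m - Suc i) div p}"
  proof
    fix n assume n: "n \<in> {n. n < m \<and> i \<le> n \<and> p dvd (n - i)}"
    then obtain q where q: "n = i + p * q" by (metis (mono_tags) dvdE le_add_diff_inverse mem_Collect_eq)
    then have "q * p \<le> m - Suc i" using n by (simp add: mult.commute)
    then have "q \<le> (m - Suc i) div p" using p by (simp add: less_eq_div_iff_mult_less_eq)
    with q show "n \<in> (\<lambda>q. i + p * q) ` {..(m - Suc i) div p}" by blast
  qed
  then have "card {n. n < m \<and> i \<le> n \<and> p dvd (n - i)} \<le> card {..(m - Suc i) div p}"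
    by (rule surj_card_le[rotated]) simp
  then show ?thesis by simp
qed

context uniserial_module
begin

lemma act_diff_left: "act (y - z) u = act y u - act z u"
proof -
  interpret a: Vector_Spaces.linear scale uscale "\<lambda>y. act y u" by (rule act_linear_left)
  show ?thesis by (rule a.diff)
qed

text \<open>An element of \<open>A\<close> is determined by its value on a cyclic vector, and for an eigenvector of
  eigenvalue \<open>\<delta>\<close> this value lies in the span of the \<open>v\<^sup>n w\<close> with \<open>n = \<delta>\<close> in \<open>F\<close>.\<close>

lemma multiplicity_le:
  assumes v: "v \<in> E 1" and m: "0 < m" and w: "cyclic v w" and faithful: "faithful_action act"
  shows "dim (E \<delta>) \<le> card {n. n < m \<and> of_nat n = \<delta>}"
proof -
  let ?N = "{n. n < m \<and> of_nat n = \<delta>}"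
  interpret vector_space_pair scale uscale by unfold_locales
  obtain B where B: "B \<subseteq> E \<delta>" "independent B" "E \<delta> \<subseteq> span B" "card B = dim (E \<delta>)"
    by (rule basis_exists)
  have span: "span B \<subseteq> E \<delta>" using B(1) subspace_E by (rule span_minimal)
  have inj: "inj_on (\<lambda>a. act a w) (E \<delta>)"
  proof (rule inj_onI)
    fix a a' assume a: "a \<in> E \<delta>" "a' \<in> E \<delta>" "act a w = act a' w"
    have "a - a' \<in> A" using subspace_diff[OF subspace_E a(1,2)] by (rule E_in_A)
    moreover have "act (a - a') w = 0" using a(3) by (simp add: act_diff_left)
    moreover have "coord v w 0 n = 0" for n
      using coord_scale[OF v m w, of 0 0 n] by simp
    ultimately have "act (a - a') u = 0" for u
      using A_acts_by_polynomial[OF v m w, of "a - a'" u] by simp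
    then have "a - a' = 0" using faithful unfolding faithful_action_def by blast
    then show "a = a'" by simp
  qed
  have "U.independent ((\<lambda>a. act a w) ` B)"
    using linear_independent_injective_image[OF act_linear_left B(2)] inj_on_subset[OF inj span] .
  moreover have "(\<lambda>a. act a w) ` B \<subseteq> U.span ((\<lambda>n. V v n w) ` ?N)"
  proof (rule image_subsetI)
    fix a assume "a \<in> B"
    then have a: "a \<in> E \<delta>" using B(1) by blast
    have "(\<Sum>n<m. uscale (coord v w (act a w) n) (V v n w)) \<in> U.span ((\<lambda>n. V v n w) ` ?N)"
    proof (rule U.span_sum)
      fix n assume n: "n \<in> {..<m}"
      show "uscale (coord v w (act a w) n) (V v n w) \<in> U.span ((\<lambda>n. V v n w) ` ?N)"
      proof (cases "coord v w (act a w) n = 0")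
        case False
        then have "n \<in> ?N" using E_exponents[OF v m w a] n by simp
        then show ?thesis by (intro U.span_scale U.span_base imageI)
      qed (simp add: U.span_zero)
    qed
    then show "act a w \<in> U.span ((\<lambda>n. V v n w) ` ?N)"
      by (simp only: coord_expand[OF v m w, of "act a w", symmetric])
  qed
  ultimately have "card ((\<lambda>a. act a w) ` B) \<le> card ((\<lambda>n. V v n w) ` ?N)"
    using U.independent_span_bound by simp
  also have "\<dots> \<le> card ?N" by (rule card_image_le) simp
  also have "card ((\<lambda>a. act a w) ` B) = dim (E \<delta>)"
    using B(4) card_image[OF inj_on_subset[OF inj B(1)]] by simp
  finally show ?thesis .
qed

lemma multiplicity_bound:
  assumes v: "v \<in> E 1" and m: "0 < m" and w: "cyclic v w" and faithful: "faithful_action act"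
    and char: "CHAR('f) = p" and i: "i < p" "p < m"
  shows "int (dim (E (of_nat i))) \<le> \<lfloor>(real m - (real i + 1)) / real p\<rfloor> + 1"
proof -
  have "dim (E (of_nat i)) \<le> card {n. n < m \<and> (of_nat n :: 'f) = of_nat i}"
    by (rule multiplicity_le[OF v m w faithful])
  also have "\<dots> \<le> card {n. n < m \<and> i \<le> n \<and> p dvd (n - i)}"
    by (rule card_mono) (use of_nat_eq_of_nat_iff[OF char _ i(1)] in auto)
  also have "\<dots> \<le> (m - Suc i) div p + 1"
    by (rule card_residue_class_le) (use i in auto)
  finally have "int (dim (E (of_nat i))) \<le> int ((m - Suc i) div p) + 1" by linarith
  also have "int ((m - Suc i) div p) = \<lfloor>real (m - Suc i) / real p\<rfloor>"
    by (simp add: floor_divide_of_nat_eq)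
  also have "real (m - Suc i) = real m - (real i + 1)"
    using i by (simp add: of_nat_diff)
  finally show ?thesis .
qed

lemma matrix_form:
  assumes v: "v \<in> E 1" and w0: "(act v ^^ (m - 1)) w0 \<noteq> 0"
    and p: "prime p" "CHAR('f) = p" "p < m"
  shows "has_matrix_form scale bracket uscale act A x p m v"
proof -
  have m: "0 < m" and p1: "1 < p" "0 < p" using p prime_gt_1_nat[of p] by auto
  have invertible: "(of_nat n :: 'f) \<noteq> 0" if "\<not> p dvd n" for n
    using that p(2) of_nat_eq_0_iff_char_dvd[where 'a = 'f, of n] by simp
  have "cyclic v w0" using w0 by (simp add: cyclic_def[OF v m])
  then obtain w f where w: "cyclic v w" and f: "\<And>k. \<not> p dvd k \<Longrightarrow> f k = 0"
      and xw: "act x w = (\<Sum>k<m. uscale (f k) (V v k w))"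
    using normalized_cyclic_vector[OF v m invertible] by blast
  define g where "g i u = toeplitz m (coord v w (act u w))" for i :: nat and u
  define f' where "f' k = (if k = 0 then 0 else f k)" for k
  have lin: "mat_linear_on scale (E (of_nat i)) (g i)" for i
    unfolding mat_linear_on_def g_def toeplitz_add[symmetric] toeplitz_smult[symmetric]
    by (simp add: act_add_left act_scale_left coord_add[OF v m w, abs_def] coord_scale[OF v m w, abs_def])
  have FJ: "g i u \<in> FJ p m i" if "i < p" "u \<in> E (of_nat i)" for i u
    unfolding g_def
  proof (rule toeplitz_in_FJ[OF p1(2)])
    fix n assume "n < m" "coord v w (act u w) n \<noteq> 0"
    then have "(of_nat n :: 'f) = of_nat i" by (rule E_exponents[OF v m w that(2)])
    then show "i \<le> n \<and> p dvd (n - i)" by (rule of_nat_eq_of_nat_iff[OF p(2) _ that(1)])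
  qed
  have J: "g 1 v = J_mat m"
    unfolding g_def J_mat_eq_toeplitz
  proof (rule toeplitz_cong)
    fix n assume n: "n < m"
    have "act v w = (\<Sum>k<m. uscale (if k = 1 then 1 else 0) (V v k w))"
      using p1 p(3) by (simp add: if_distrib[of "\<lambda>c. uscale c _"] cong: if_cong)
    then show "coord v w (act v w) n = (if n = 1 then 1 else 0)"
      using coord_unique[OF v m w n, of "\<lambda>k. if k = 1 then 1 else 0"] by simp
  qed
  have "toeplitz m f' \<in> FJ p m p"
  proof (rule toeplitz_in_FJ[OF p1(2)])
    fix n assume "f' n \<noteq> 0"
    then have "n \<noteq> 0" "p dvd n" using f by (auto simp: f'_def split: if_splits)
    then show "p \<le> n \<and> p dvd (n - p)" by (auto simp: dvd_imp_le)
  qed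
  moreover have "represented_by uscale (es v w) (act x)
      (D_mat m (f 0 + of_nat (m - 1)) + toeplitz m f')"
    unfolding f'_def by (rule x_represented[OF v m w xw])
  ultimately show ?thesis
    unfolding has_matrix_form_def
    using lin FJ J es_basis[OF v m w] A_represented[OF v m w E_in_A]
    by (intro exI[of _ g] exI[of _ "f 0 + of_nat (m - 1)"]
        exI[of _ "D_mat m (f 0 + of_nat (m - 1)) + toeplitz m f'"] exI[of _ "es v w"])
      (auto simp: g_def)
qed

text \<open>A non-trivially acting eigenvector shifts between weights of \<open>x\<close>, and these are consecutive.\<close>

lemma nontrivial_weight:
  assumes v: "v \<in> E 1" and m: "0 < m" and w: "cyclic v w"
    and \<delta>: "\<delta> \<in> nontrivial_eigenvalues scale bracket act A x"
  obtains j where "\<delta> = of_nat j"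
proof -
  obtain a u where "a \<in> E \<delta>" "act a u \<noteq> 0"
    using \<delta> by (auto simp: nontrivial_eigenvalues_def acts_trivially_def)
  then obtain j where "j < m" "\<delta> = wt 0 - wt j"
    using weight_is_difference[OF weight_operator_E] by blast
  with weights_consecutive[OF v m w] that show ?thesis by auto
qed

end

section \<open>Rescaling \<open>x\<close>\<close>

lemma of_nat_in_prime_subfield: "of_nat n \<in> (prime_subfield :: 'f::field set)"
  unfolding prime_subfield_def
proof (rule InterI)
  fix K :: "'f set" assume "K \<in> {K. is_subfield K}"
  then show "of_nat n \<in> K" by (induction n) (auto simp: is_subfield_def)
qed

context line_extension
begin

text \<open>If only the eigenvalue \<open>0\<close> acts, then \<open>x\<close> commutes with \<open>A\<close> on \<open>U\<close>, and so the whole algebra acts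
  commutatively.\<close>

lemma derived_acts_trivially:
  assumes triv: "\<And>\<delta> a u. \<delta> \<noteq> 0 \<Longrightarrow> a \<in> E \<delta> \<Longrightarrow> act a u = 0"
  shows "acts_trivially act (derived_algebra scale bracket)"
proof -
  define C where "C z y \<longleftrightarrow> (\<forall>u. act y (act z u) = act z (act y u))" for z y
  have sub: "subspace {y. C z y}" for z
    by (auto simp: C_def subspace_def act_zero_left act_zero act_add_left act_scale_left act_add
        act_uscale)
  have xE: "C x a" if "a \<in> E \<delta>" for a \<delta>
    using act_x_E[OF that] triv[OF _ that] unfolding C_def by (cases "\<delta> = 0") (auto simp: act_zero)
  have xA: "C x a" if "a \<in> A" for a
    by (rule A_induct[OF sub xE that])
  have Ay: "C a y" if a: "a \<in> A" for a y
    by (rule g_induct[OF sub]) (use xA[OF a] act_A_commute[OF _ a] in \<open>auto simp: C_def\<close>)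
  have xy: "C x y" for y
    by (rule g_induct[OF sub]) (auto simp: xA, simp add: C_def)
  have comm: "C z y" for z y
    by (rule g_induct[OF sub]) (use xy[of z] Ay[of _ z] in \<open>auto simp: C_def\<close>)
  have zero: "subspace {y. \<forall>u. act y u = 0}"
    by (auto simp: subspace_def act_zero_left act_add_left act_scale_left)
  have "act (bracket y z) u = 0" for y z u
    using comm[of y z] by (simp add: act_bracket C_def)
  then have "span {bracket y z |y z. True} \<subseteq> {y. \<forall>u. act y u = 0}"
    by (intro span_minimal zero) auto
  then show ?thesis by (auto simp: acts_trivially_def derived_algebra_def)
qed

lemma line_complement_rescale:
  assumes "c \<noteq> 0"
  shows "line_complement scale (scale c x) A"
proof -
  have "span {scale c x} = span {x}"
  proof (rule span_eq[THEN iffD2], intro conjI)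
    show "{scale c x} \<subseteq> span {x}" by (simp add: span_base span_scale)
    have "scale (inverse c) (scale c x) \<in> span {scale c x}" by (intro span_scale span_base) simp
    then show "{x} \<subseteq> span {scale c x}" using assms by simp
  qed
  then show ?thesis using complement by (simp add: line_complement_def)
qed

lemma bracket_rescale: "bracket (scale c x) y = scale c (bracket x y)"
proof -
  interpret a: Vector_Spaces.linear scale scale "\<lambda>z. bracket z y" by (rule bracket_linear_left)
  show ?thesis by (rule a.scale)
qed

lemma ad_diagonalizable_rescale: "ad_diagonalizable_on scale bracket (scale c x) A"
  using diagonalizable unfolding ad_diagonalizable_on_def
  by (auto simp: bracket_rescale) (metis scale_scale)

lemma line_extension_rescale:
  assumes "c \<noteq> 0"
  shows "line_extension scale bracket uscale act (scale c x) A"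
  by (intro line_extension.intro lie_module_axioms line_extension_axioms.intro ideal
      line_complement_rescale[OF assms] ad_diagonalizable_rescale admissible)

end

theorem theorem3p8:
  fixes scale :: "'f::alg_closed_field \<Rightarrow> 'g::ab_group_add \<Rightarrow> 'g"
    and bracket :: "'g \<Rightarrow> 'g \<Rightarrow> 'g"
    and uscale :: "'f \<Rightarrow> 'u::ab_group_add \<Rightarrow> 'u"
    and act :: "'g \<Rightarrow> 'u \<Rightarrow> 'u"
    and x :: 'g and A :: "'g set" and p m :: nat
  assumes "prime p" and "CHAR('f) = p"
    and "lie_module scale bracket uscale act"
    and "\<exists>B. finite_dimensional_vector_space scale B"
    and "\<exists>B. finite_dimensional_vector_space uscale B"
    and "abelian_ideal scale bracket A"
    and "line_complement scale x A"
    and "ad_diagonalizable_on scale bracket x A"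
    and "admissible scale bracket act"
    and "uniserial uscale act"
    and "has_composition_length uscale act m"
    and "m > p"
    and "\<not> acts_trivially act (derived_algebra scale bracket)"
  shows "m = vector_space.dim uscale (UNIV :: 'u set) \<and> m > 1 \<and>
    (\<exists>c x'. c \<noteq> 0 \<and> x' = scale c x \<and>
       1 \<in> nontrivial_eigenvalues scale bracket act A x' \<and>
       nontrivial_eigenvalues scale bracket act A x' \<subseteq> prime_subfield \<and>
       (faithful_action act \<longrightarrow>
          (\<forall>\<delta>. ad_eigenvalue scale bracket A x' \<delta> \<longrightarrow>
             (\<exists>i<p. \<delta> = of_nat i \<and>
                int (vector_space.dim scale (ad_eigenspace scale bracket A x' \<delta>))
                  \<le> \<lfloor>(real m - (real i + 1)) / real p\<rfloor> + 1))) \<and>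
       (\<exists>v \<in> ad_eigenspace scale bracket A x' 1. \<exists>u. (act v ^^ (m - 1)) u \<noteq> 0) \<and>
       (\<forall>v \<in> ad_eigenspace scale bracket A x' 1.
          (\<exists>u. (act v ^^ (m - 1)) u \<noteq> 0) \<longrightarrow>
          has_matrix_form scale bracket uscale act A x' p m v))"
proof -
  have p: "1 < p" using assms(1) by (rule prime_gt_1_nat)
  then have m: "1 < m" "0 < m" using assms(12) by auto
  interpret M: line_extension scale bracket uscale act x A
    using assms(3,6-9) by (intro line_extension.intro line_extension_axioms.intro)
  interpret M: uniserial_module scale bracket uscale act x A m
    using assms(5,10,11) by unfold_locales
  obtain a \<delta> u where a: "\<delta> \<noteq> 0" "a \<in> M.E \<delta>" "act a u \<noteq> 0"
    using M.derived_acts_trivially assms(13) by blast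
  then obtain \<delta> v where v: "\<delta> \<noteq> 0" "v \<in> M.E \<delta>" "act v (M.e 1) \<noteq> 0"
    using M.non_central_jordan_vector_exists[OF m(1) a(2,1,3)] by blast
  obtain w where w: "(act v ^^ (m - 1)) w \<noteq> 0"
    using M.jordan_vector_power_nonzero[OF v(2,1,3) m(2)] by blast
  define x' where "x' = scale (inverse \<delta>) x"
  have "inverse \<delta> \<noteq> 0" using v(1) by simp
  then interpret N: line_extension scale bracket uscale act x' A
    unfolding x'_def by (rule M.line_extension_rescale)
  interpret N: uniserial_module scale bracket uscale act x' A m
    using assms(5,10,11) by unfold_locales
  have v1: "v \<in> N.E 1"
    using v(1,2) by (simp add: ad_eigenspace_def x'_def M.bracket_rescale)
  have cyc: "N.cyclic v w" using w by (simp add: N.cyclic_def[OF v1 m(2)])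
  have "(act v ^^ (m - 1)) w = 0" if "\<And>u. act v u = 0"
    using that m by (cases "m - 1") auto
  with w have nontriv: "\<not> acts_trivially act (N.E 1)"
    using v1 unfolding acts_trivially_def by blast
  have "v \<noteq> 0" using v(3) M.act_zero_left by auto
  with v1 nontriv have one: "1 \<in> nontrivial_eigenvalues scale bracket act A x'"
    by (auto simp: nontrivial_eigenvalues_def ad_eigenvalue_def)
  have prime: "nontrivial_eigenvalues scale bracket act A x' \<subseteq> prime_subfield"
    using N.nontrivial_weight[OF v1 m(2) cyc] of_nat_in_prime_subfield by blast
  have mult: "\<exists>i<p. \<delta> = of_nat i \<and>
      int (vector_space.dim scale (N.E \<delta>)) \<le> \<lfloor>(real m - (real i + 1)) / real p\<rfloor> + 1"
    if faithful: "faithful_action act" and ev: "ad_eigenvalue scale bracket A x' \<delta>" for \<delta>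
  proof -
    obtain a where "a \<in> N.E \<delta>" "a \<noteq> 0" using ev by (auto simp: ad_eigenvalue_def)
    then have "\<not> acts_trivially act (N.E \<delta>)"
      using faithful unfolding faithful_action_def acts_trivially_def by blast
    then have "\<delta> \<in> nontrivial_eigenvalues scale bracket act A x'"
      using ev by (simp add: nontrivial_eigenvalues_def)
    then obtain j where j: "\<delta> = of_nat j" using N.nontrivial_weight[OF v1 m(2) cyc] by blast
    have "(of_nat j :: 'f) = of_nat (j mod p)"
      using assms(2) by (simp add: of_nat_eq_iff_cong_CHAR cong_def)
    then have "\<delta> = of_nat (j mod p)" using j by simp
    moreover have "j mod p < p" using p by simp
    ultimately show ?thesis
      using N.multiplicity_bound[OF v1 m(2) cyc faithful assms(2) _ assms(12), of "j mod p"] by blast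
  qed
  show ?thesis
  proof (intro conjI exI[of _ "inverse \<delta>"] exI[of _ x'])
    show "m = vector_space.dim uscale (UNIV :: 'u set)" by (rule M.dim_UNIV[symmetric])
    show "\<exists>v \<in> N.E 1. \<exists>u. (act v ^^ (m - 1)) u \<noteq> 0" using v1 w by blast
    show "\<forall>v \<in> N.E 1. (\<exists>u. (act v ^^ (m - 1)) u \<noteq> 0) \<longrightarrow>
        has_matrix_form scale bracket uscale act A x' p m v"
      using N.matrix_form[OF _ _ assms(1,2,12)] by blast
  qed (use m one prime mult \<open>inverse \<delta> \<noteq> 0\<close> x'_def in auto)
qed

end
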